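(* Assume the setting and conditions (A1)–(A7) described in the context. Then the impulsive system (2) replicates the sensitivity of system (1) in the following sense. Suppose system (1) is sensitive: there exist $\epsilon_0>0$ and $\Delta>0$ such that for every $\delta_0>0$ and every $x\in\mathscr A$ there exist $\overline{x}\in\mathscr A$, $t_0\in\mathbb R$ and an interval $J\subset[t_0,\infty)$ of length at least $\Delta$ with $\|x(t_0)-\overline{x}(t_0)\|<\delta_0$ and $\|x(t)-\overline{x}(t)\|>\epsilon_0$ for all $t\in J$. Then there exist $\epsilon_1>0$ and $\overline{\Delta}>0$ such that for every $\delta_1>0$ and every $x\in\mathscr A$ there exist $\overline{x}\in\mathscr A$, $t_0\in\mathbb R$ and an interval $J^1\subset[t_0,\infty)$ of length at least $\overline{\Delta}$, containing at most one element of the sequence $\{\theta_k\}$, such that $$\|\phi_{x}(t_0)-\phi_{\overline{x}}(t_0)\|<\delta_1\quad\text{and}\quad \|\phi_{x}(t)-\phi_{\overline{x}}(t)\|>\epsilon_1 \text{ for all } t\in J^1.$$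
   Context: Norms are Euclidean for vectors and the induced operator norm for matrices. System (1): $x'=F(t,x)$, where $F:\mathbb R\times\mathbb R^m\to\mathbb R^m$ is continuous and $T$-periodic in $t$ ($T>0$). $\mathscr A$ denotes the (assumed nonempty) set of all solutions of (1) that are uniformly bounded on $\mathbb R$, and $\Lambda\subset\mathbb R^m$ is a compact set containing the trajectories of all elements of $\mathscr A$. System (2) (impulsive, driven by $x\in\mathscr A$): $y'=Ay+f(t,y)+g(x(t))$ for $t\neq\theta_k$, and $y(\theta_k+)-y(\theta_k)=By(\theta_k)+W(y(\theta_k))$, $k\in\mathbb Z$, where $f:\mathbb R\times\mathbb R^n\to\mathbb R^n$, $g:\mathbb R^m\to\mathbb R^n$, $W:\mathbb R^n\to\mathbb R^n$ are continuous, $f(t+T,y)=f(t,y)$, $A,B$ are real constant $n\times n$ matrices, $\{\theta_k\}_{k\in\mathbb Z}$ is strictly increasing with $\theta_{k+p}=\theta_k+T$ for some fixed $p\in\mathbb N$. Solutions are left-continuous, with first-kind discontinuities only at the $\theta_k$, satisfying the differential equation off $\{\theta_k\}$ (with left derivative at $\theta_k$) and the jump condition. $U(t,s)$ is the transition matrix of $u'=Au$ ($t\ne\theta_k$), $\Delta u|_{t=\theta_k}=Bu$. Conditions: (A1) $AB=BA$ and $\det(I+B)\neq0$. (A2) all eigenvalues of $A+\frac{p}{T}\ln(I+B)$ have negative real parts. Under (A1),(A2) there exist $N>0,\omega>0$ with $\|U(t,s)\|\le Ne^{-\omega(t-s)}$ for $t\ge s$; fix such $N,\omega$. (A3) $\sup_{t,y}\|f(t,y)\|\le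 M_f$, $\sup_y\|W(y)\|\le M_W$ for some positive $M_f,M_W$. (A4) there are positive $L_F,L_f,L_1,L_2,L_W$ with: $\|F(t,x_1)-F(t,x_2)\|\le L_F\|x_1-x_2\|$ for $t\in\mathbb R$, $x_1,x_2\in\Lambda$; $\|f(t,y_1)-f(t,y_2)\|\le L_f\|y_1-y_2\|$; $L_1\|x_1-x_2\|\le\|g(x_1)-g(x_2)\|\le L_2\|x_1-x_2\|$ for $x_1,x_2\in\Lambda$; $\|W(y_1)-W(y_2)\|\le L_W\|y_1-y_2\|$. (A5) $N\big(\frac{L_f}{\omega}+\frac{pL_W}{1-e^{-\omega T}}\big)<1$. (A6) $-\omega+NL_f+\frac pT\ln(1+NL_W)<0$. (A7) $L_W\|(I+B)^{-1}\|<1$. Under these conditions, for each $x\in\mathscr A$ system (2) has a unique solution $\phi_x$ bounded on $\mathbb R$; it satisfies $\phi_x(t)=\int_{-\infty}^tU(t,s)[f(s,\phi_x(s))+g(x(s))]ds+\sum_{\theta_k<t}U(t,\theta_k+)W(\phi_x(\theta_k))$. *)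

theory Defs
  imports "HOL-Analysis.Analysis"
begin

primrec mpow :: "('a::semiring_1)^'n^'n \<Rightarrow> nat \<Rightarrow> 'a^'n^'n" where
  "mpow M 0 = mat 1"
| "mpow M (Suc k) = M ** mpow M k"

definition mexp :: "('a::real_normed_field)^'n^'n \<Rightarrow> 'a^'n^'n" where
  "mexp M = (\<Sum>k. (1 / fact k) *\<^sub>R mpow M k)"

definition cmat :: "real^'n^'n \<Rightarrow> complex^'n^'n" where
  "cmat M = (\<chi> i j. complex_of_real (M $ i $ j))"

definition opnorm :: "real^'n^'n \<Rightarrow> real" where
  "opnorm M = onorm (\<lambda>v. M *v v)"

text \<open>Transition matrix U(t,s), t \<ge> s, of  u' = A u (t \<noteq> \<theta>_k),  \<Delta>u|_{t=\<theta>_k} = B u,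
  for commuting A, B and left-continuous solutions: the jumps at the moments
  \<theta>_k \<in> [s,t) are taken.\<close>
definition transU :: "real^'n^'n \<Rightarrow> real^'n^'n \<Rightarrow> (int \<Rightarrow> real) \<Rightarrow> real \<Rightarrow> real \<Rightarrow> real^'n^'n" where
  "transU A B \<theta> t s = mexp ((t - s) *\<^sub>R A) ** mpow (mat 1 + B) (card {k. s \<le> \<theta> k \<and> \<theta> k < t})"

definition is_sol1 :: "(real \<Rightarrow> real^'m \<Rightarrow> real^'m) \<Rightarrow> (real \<Rightarrow> real^'m) \<Rightarrow> bool" where
  "is_sol1 F x \<longleftrightarrow> (\<forall>t. (x has_vector_derivative F t (x t)) (at t))"

definition bdd_sols1 :: "(real \<Rightarrow> real^'m \<Rightarrow> real^'m) \<Rightarrow> (real \<Rightarrow> real^'m) set" where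
  "bdd_sols1 F = {x. is_sol1 F x \<and> bounded (range x)}"

text \<open>Solutions of the impulsive system (2) driven by x: left-continuous, first-kind
  discontinuities only at the \<theta>_k, the ODE off {\<theta>_k}, left derivative at \<theta>_k, jump condition.\<close>
definition is_sol2 ::
  "real^'n^'n \<Rightarrow> real^'n^'n \<Rightarrow> (real \<Rightarrow> real^'n \<Rightarrow> real^'n) \<Rightarrow> (real^'m \<Rightarrow> real^'n)
    \<Rightarrow> (real^'n \<Rightarrow> real^'n) \<Rightarrow> (int \<Rightarrow> real) \<Rightarrow> (real \<Rightarrow> real^'m) \<Rightarrow> (real \<Rightarrow> real^'n) \<Rightarrow> bool" where
  "is_sol2 A B f g W \<theta> x y \<longleftrightarrow>
     (\<forall>t. t \<notin> range \<theta> \<longrightarrow>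
        (y has_vector_derivative (A *v y t + f t (y t) + g (x t))) (at t)) \<and>
     (\<forall>k. (y has_vector_derivative (A *v y (\<theta> k) + f (\<theta> k) (y (\<theta> k)) + g (x (\<theta> k))))
            (at (\<theta> k) within {..\<theta> k})) \<and>
     (\<forall>k. \<exists>l. (y \<longlongrightarrow> l) (at_right (\<theta> k)) \<and> l - y (\<theta> k) = B *v y (\<theta> k) + W (y (\<theta> k)))"

definition interval_len_ge :: "real set \<Rightarrow> real \<Rightarrow> bool" where
  "interval_len_ge J d \<longleftrightarrow> (\<exists>a b. a \<le> b \<and> d \<le> b - a \<and> {a<..<b} \<subseteq> J \<and> J \<subseteq> {a..b})"

end

theory Submission
  imports Defs
begin

text \<open>
  For two bounded solutions \<open>x\<close>, \<open>xb\<close> put \<open>y = \<phi> x - \<phi> xb\<close>. It solves a linear impulsive equation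
  whose forcing and jumps are Lipschitz in \<open>y\<close> up to \<open>G = g \<circ> x - g \<circ> xb\<close>. By (A5) the exponential decay of \<open>U\<close>
  contracts the supremum of \<open>\<bar>y\<bar>\<close> over long time windows, up to the size of \<open>G\<close>; since \<open>F\<close> is Lipschitz
  on \<open>\<Lambda>\<close>, closeness of \<open>x\<close> and \<open>xb\<close> at \<open>t\<^sub>0\<close> makes \<open>G\<close> small on a long window before \<open>t\<^sub>0\<close>, so
  \<open>y(t\<^sub>0)\<close> is small. Conversely, where \<open>x\<close> and \<open>xb\<close> are separated, \<open>G\<close> is bounded below and slowly
  varying, and on an interval between two jumps it must push \<open>y\<close> away from \<open>0\<close>; as \<open>y'\<close> is bounded
  there, \<open>y\<close> stays away from \<open>0\<close> on a subinterval of fixed length.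
\<close>

subsection \<open>The matrix exponential\<close>

lemma bounded_bilinear_matrix_vector_mult:
  "bounded_bilinear (\<lambda>(M::real^'n^'m) v. M *v v)"
  unfolding bilinear_conv_bounded_bilinear[symmetric] bilinear_def linear_iff
  by (simp add: matrix_vector_mult_add_rdistrib matrix_vector_right_distrib
      matrix_vector_mult_scaleR scaleR_matrix_vector_assoc)

text \<open>Reduces matrix derivatives to real entries, where termwise differentiation of power
  series applies.\<close>

lemma has_vector_derivative_matrix:
  fixes M :: "real \<Rightarrow> real^'n^'m"
  assumes "\<And>i j. ((\<lambda>r. M r $ i $ j) has_real_derivative D $ i $ j) (at r within S)"
  shows "(M has_vector_derivative D) (at r within S)"
  unfolding has_vector_derivative_def
proof (subst has_derivative_componentwise_within, intro ballI)
  fix b :: "real^'n^'m" assume "b \<in> Basis"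
  then obtain i j where b: "b = axis i (axis j 1)"
    by (auto simp: Basis_vec_def)
  show "((\<lambda>x. M x \<bullet> b) has_derivative (\<lambda>x. x *\<^sub>R D \<bullet> b)) (at r within S)"
    using assms[of i j] by (simp add: b inner_axis has_field_derivative_def mult_commute_abs)
qed

lemma norm_matrix_vector_le: "norm (M *v v) \<le> opnorm M * norm v"
  for M :: "real^'n^'n"
  unfolding opnorm_def by (rule onorm) simp

lemma opnorm_nonneg: "0 \<le> opnorm M"
  unfolding opnorm_def by (rule onorm_pos_le) simp

lemma norm_mpow_vector_le: "norm (mpow M k *v v) \<le> opnorm M ^ k * norm v"
  for M :: "real^'n^'n"
proof (induction k)
  case (Suc k)
  have "norm (mpow M (Suc k) *v v) \<le> opnorm M * norm (mpow M k *v v)"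
    by (simp add: norm_matrix_vector_le flip: matrix_vector_mul_assoc)
  also have "\<dots> \<le> opnorm M * (opnorm M ^ k * norm v)"
    by (intro mult_left_mono Suc opnorm_nonneg)
  finally show ?case by (simp add: mult.assoc)
qed simp

text \<open>Entry (i,j) is the i-th coordinate of the k-th power applied to the j-th unit vector.
  This majorizes each entry of the exponential series by a scalar exponential series.\<close>

lemma abs_mpow_component_le: "\<bar>mpow M k $ i $ j\<bar> \<le> opnorm M ^ k"
  for M :: "real^'n^'n"
proof -
  have "mpow M k $ i $ j = (mpow M k *v axis j 1) $ i"
    by (simp add: matrix_vector_mult_basis column_def)
  also have "\<bar>\<dots>\<bar> \<le> norm (mpow M k *v axis j 1)"
    by (rule component_le_norm_cart)
  also have "\<dots> \<le> opnorm M ^ k"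
    using norm_mpow_vector_le[of M k "axis j 1"] by (simp add: norm_axis_1)
  finally show ?thesis .
qed

lemma mpow_commute:
  assumes "M ** C = C ** M"
  shows "mpow M k ** C = C ** mpow M k"
  by (induction k) (simp_all, metis assms matrix_mul_assoc)

lemma mpow_Suc_right: "mpow M (Suc k) = mpow M k ** M"
  using mpow_commute[of M M k] by simp

lemma mpow_scaleR: "mpow (r *\<^sub>R M) k = r ^ k *\<^sub>R mpow M k"
  for M :: "real^'n^'n"
proof (induction k)
  case (Suc k)
  have "(r *\<^sub>R M) ** (r ^ k *\<^sub>R mpow M k) = (r * r ^ k) *\<^sub>R (M ** mpow M k)"
    by (simp add: vec_eq_iff matrix_matrix_mult_def sum_distrib_left mult_ac)
  then show ?case using Suc by simp
qed simp

lemma summable_mpow_component: "summable (\<lambda>k. mpow M k $ i $ j / fact k * r ^ k)"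
  for M :: "real^'n^'n"
proof (rule summable_comparison_test')
  show "summable (\<lambda>k. inverse (fact k) * (opnorm M * \<bar>r\<bar>) ^ k :: real)"
    by (rule summable_exp)
  show "norm (mpow M k $ i $ j / fact k * r ^ k) \<le> inverse (fact k) * (opnorm M * \<bar>r\<bar>) ^ k" for k
    using abs_mpow_component_le[of M k i j]
    by (simp add: abs_mult power_abs power_mult_distrib divide_simps mult_right_mono)
qed

text \<open>Convergence of the matrix series is entrywise, and powers of r split off by
  \<open>mpow_scaleR\<close>. Each entry thus becomes a scalar power series in r.\<close>

lemma mexp_component:
  "mexp (r *\<^sub>R M) $ i $ j = (\<Sum>k. mpow M k $ i $ j / fact k * r ^ k)"
  for M :: "real^'n^'n"
proof -
  let ?E = "\<chi> i j. (\<Sum>k. mpow M k $ i $ j / fact k * r ^ k)"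
  have "(\<lambda>n. \<Sum>k<n. (1 / fact k) *\<^sub>R mpow (r *\<^sub>R M) k) \<longlonglongrightarrow> ?E"
  proof (intro vec_tendstoI)
    fix i j
    have "(\<lambda>n. \<Sum>k<n. mpow M k $ i $ j / fact k * r ^ k) \<longlonglongrightarrow> ?E $ i $ j"
      using summable_LIMSEQ[OF summable_mpow_component[of M i j r]] by simp
    then show "(\<lambda>n. (\<Sum>k<n. (1 / fact k) *\<^sub>R mpow (r *\<^sub>R M) k) $ i $ j) \<longlonglongrightarrow> ?E $ i $ j"
      by (simp add: mpow_scaleR mult_ac)
  qed
  then have "mexp (r *\<^sub>R M) = ?E"
    unfolding mexp_def sums_def[symmetric] by (rule sums_unique[symmetric])
  then show ?thesis by simp
qed

text \<open>Termwise differentiation shifts the coefficients to \<open>mpow M (Suc k)\<close>; the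
  extra factor is split off on the right, next to the vector, where it later cancels the
  \<open>A\<close> of the differential equation.\<close>

lemma mexp_has_vector_derivative:
  "((\<lambda>r. mexp (r *\<^sub>R M)) has_vector_derivative mexp (r *\<^sub>R M) ** M) (at r within S)"
  for M :: "real^'n^'n"
proof (rule has_vector_derivative_matrix)
  fix i j
  have "diffs (\<lambda>k. mpow M k $ i $ j / fact k) k * r ^ k
      = (\<Sum>l\<in>UNIV. mpow M k $ i $ l / fact k * r ^ k * M $ l $ j)" for k
  proof -
    have "mpow M (Suc k) $ i $ j = (\<Sum>l\<in>UNIV. mpow M k $ i $ l * M $ l $ j)"
      by (simp only: mpow_Suc_right) (simp add: matrix_matrix_mult_def)
    \<comment> \<open>The factor k+1 introduced by \<open>diffs\<close> cancels against the
      factorial of k+1.\<close>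
    moreover have "diffs (\<lambda>k. mpow M k $ i $ j / fact k) k = mpow M (Suc k) $ i $ j / fact k"
      by (simp add: diffs_def field_simps del: mpow.simps of_nat_Suc)
    ultimately show ?thesis
      by (simp add: sum_distrib_left sum_distrib_right sum_divide_distrib mult_ac)
  qed
  then have "(\<Sum>k. diffs (\<lambda>k. mpow M k $ i $ j / fact k) k * r ^ k)
      = (\<Sum>k. \<Sum>l\<in>UNIV. mpow M k $ i $ l / fact k * r ^ k * M $ l $ j)"
    by simp
  also have "\<dots> = (\<Sum>l\<in>UNIV. \<Sum>k. mpow M k $ i $ l / fact k * r ^ k * M $ l $ j)"
    by (intro suminf_sum summable_mult2 summable_mpow_component)
  also have "\<dots> = (mexp (r *\<^sub>R M) ** M) $ i $ j"
    by (simp only: matrix_matrix_mult_def vec_lambda_beta mexp_component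
        suminf_mult2[OF summable_mpow_component])
  finally have "(\<Sum>k. diffs (\<lambda>k. mpow M k $ i $ j / fact k) k * r ^ k)
      = (mexp (r *\<^sub>R M) ** M) $ i $ j" .
  moreover have "((\<lambda>r. mexp (r *\<^sub>R M) $ i $ j) has_real_derivative
      (\<Sum>k. diffs (\<lambda>k. mpow M k $ i $ j / fact k) k * r ^ k)) (at r within S)"
    unfolding mexp_component
    by (rule has_field_derivative_at_within, rule termdiffs_strong_converges_everywhere)
      (rule summable_mpow_component)
  ultimately show "((\<lambda>r. mexp (r *\<^sub>R M) $ i $ j) has_real_derivative
      (mexp (r *\<^sub>R M) ** M) $ i $ j) (at r within S)"
    by simp
qed

lemma mexp_zero: "mexp (0 :: real^'n^'n) = mat 1"
proof -
  have "mexp (0 *\<^sub>R (0 :: real^'n^'n)) $ i $ j = mat 1 $ i $ j" for i j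
    unfolding mexp_component by (subst suminf_finite[of "{0}"]) auto
  then show ?thesis by (simp add: vec_eq_iff)
qed

lemma continuous_on_mexp:
  fixes A :: "real^'n^'n"
  assumes "continuous_on S c"
  shows "continuous_on S (\<lambda>r. mexp (c r *\<^sub>R A))"
proof -
  have "continuous_on UNIV (\<lambda>r. mexp (r *\<^sub>R A))"
    by (rule continuous_on_vector_derivative) (rule mexp_has_vector_derivative)
  then show ?thesis
    by (rule continuous_on_compose2[OF _ assms]) simp
qed

text \<open>The nonlinear terms, evaluated along a given solution, are treated as known forcing
  \<open>h\<close> and jumps \<open>w\<close>. The equation becomes linear, so the difference of two
  solutions is again of this form.\<close>

definition linear_imp_sol ::
  "real^'n^'n \<Rightarrow> real^'n^'n \<Rightarrow> (int \<Rightarrow> real) \<Rightarrow> (real \<Rightarrow> real^'n) \<Rightarrow> (int \<Rightarrow> real^'n)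
    \<Rightarrow> (real \<Rightarrow> real^'n) \<Rightarrow> bool" where
  "linear_imp_sol A B \<theta> h w y \<longleftrightarrow>
     (\<forall>t. t \<notin> range \<theta> \<longrightarrow> (y has_vector_derivative (A *v y t + h t)) (at t)) \<and>
     (\<forall>k. (y has_vector_derivative (A *v y (\<theta> k) + h (\<theta> k))) (at (\<theta> k) within {..\<theta> k})) \<and>
     (\<forall>k. (y \<longlongrightarrow> y (\<theta> k) + B *v y (\<theta> k) + w k) (at_right (\<theta> k)))"

lemma is_sol2_imp_linear:
  assumes "is_sol2 A B f g W \<theta> x y"
  shows "linear_imp_sol A B \<theta> (\<lambda>t. f t (y t) + g (x t)) (\<lambda>k. W (y (\<theta> k))) y"
proof -
  have "(y \<longlongrightarrow> y (\<theta> k) + B *v y (\<theta> k) + W (y (\<theta> k))) (at_right (\<theta> k))" for k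
  proof -
    obtain l where l: "(y \<longlongrightarrow> l) (at_right (\<theta> k))"
      and eq: "l - y (\<theta> k) = B *v y (\<theta> k) + W (y (\<theta> k))"
      using assms unfolding is_sol2_def by blast
    have "l = y (\<theta> k) + B *v y (\<theta> k) + W (y (\<theta> k))"
      using eq by (simp add: algebra_simps)
    with l show ?thesis by simp
  qed
  with assms show ?thesis
    by (simp add: is_sol2_def linear_imp_sol_def add.assoc)
qed

lemma linear_imp_sol_diff:
  assumes "linear_imp_sol A B \<theta> h1 w1 y1" and "linear_imp_sol A B \<theta> h2 w2 y2"
  shows "linear_imp_sol A B \<theta> (\<lambda>t. h1 t - h2 t) (\<lambda>k. w1 k - w2 k) (\<lambda>t. y1 t - y2 t)"
  unfolding linear_imp_sol_def
proof (intro conjI allI impI)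
  fix t assume "t \<notin> range \<theta>"
  then have "((\<lambda>t. y1 t - y2 t) has_vector_derivative
      (A *v y1 t + h1 t) - (A *v y2 t + h2 t)) (at t)"
    using assms unfolding linear_imp_sol_def by (intro has_vector_derivative_diff) auto
  then show "((\<lambda>t. y1 t - y2 t) has_vector_derivative
      A *v (y1 t - y2 t) + (h1 t - h2 t)) (at t)"
    by (simp add: matrix_vector_mult_diff_distrib algebra_simps)
next
  fix k
  have "((\<lambda>t. y1 t - y2 t) has_vector_derivative
      (A *v y1 (\<theta> k) + h1 (\<theta> k)) - (A *v y2 (\<theta> k) + h2 (\<theta> k))) (at (\<theta> k) within {..\<theta> k})"
    using assms unfolding linear_imp_sol_def by (intro has_vector_derivative_diff) auto
  then show "((\<lambda>t. y1 t - y2 t) has_vector_derivative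
      A *v (y1 (\<theta> k) - y2 (\<theta> k)) + (h1 (\<theta> k) - h2 (\<theta> k))) (at (\<theta> k) within {..\<theta> k})"
    by (simp add: matrix_vector_mult_diff_distrib algebra_simps)
next
  fix k
  have "((\<lambda>t. y1 t - y2 t) \<longlongrightarrow> (y1 (\<theta> k) + B *v y1 (\<theta> k) + w1 k)
      - (y2 (\<theta> k) + B *v y2 (\<theta> k) + w2 k)) (at_right (\<theta> k))"
    using assms unfolding linear_imp_sol_def by (intro tendsto_diff) auto
  then show "((\<lambda>t. y1 t - y2 t) \<longlongrightarrow> y1 (\<theta> k) - y2 (\<theta> k) + B *v (y1 (\<theta> k) - y2 (\<theta> k))
      + (w1 k - w2 k)) (at_right (\<theta> k))"
    by (simp add: matrix_vector_mult_diff_distrib algebra_simps)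
qed

lemma linear_imp_sol_left_continuous:
  assumes "linear_imp_sol A B \<theta> h w y"
  shows "(y \<longlongrightarrow> y t) (at t within {..t})"
proof -
  have "(y has_vector_derivative (A *v y t + h t)) (at t within {..t})"
    using assms unfolding linear_imp_sol_def
    by (cases "t \<in> range \<theta>") (auto intro: has_vector_derivative_at_within)
  then show ?thesis
    using has_vector_derivative_continuous continuous_within by blast
qed

subsection \<open>Impulsive equations with exponentially decaying transition matrix\<close>

locale impulsive_decay =
  fixes A B :: "real^'n^'n" and \<theta> :: "int \<Rightarrow> real" and T :: real and p :: nat and N \<omega> :: real
  assumes T_pos: "T > 0"
    and theta_mono: "strict_mono \<theta>"
    and p_pos: "p \<ge> 1"
    and theta_per: "\<And>k. \<theta> (k + int p) = \<theta> k + T"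
    and A_B_comm: "A ** B = B ** A"
    and N_pos: "N > 0" and omega_pos: "\<omega> > 0"
    and U_bound: "\<And>t s. s \<le> t \<Longrightarrow> opnorm (transU A B \<theta> t s) \<le> N * exp (- \<omega> * (t - s))"
begin

section \<open>Spacing of the jump moments and exponential sums over them\<close>

lemma theta_shift: "\<theta> (k + int p * int j) = \<theta> k + real j * T"
proof (induction j)
  case (Suc j)
  have "\<theta> (k + int p * int (Suc j)) = \<theta> ((k + int p * int j) + int p)"
    by (simp add: algebra_simps)
  also have "\<dots> = \<theta> k + real j * T + T" by (simp only: theta_per Suc)
  finally show ?case by (simp add: algebra_simps)
qed simp

lemma theta_less_iff: "\<theta> k < \<theta> l \<longleftrightarrow> k < l"
  using theta_mono by (rule strict_mono_less)

lemma theta_le_iff: "\<theta> k \<le> \<theta> l \<longleftrightarrow> k \<le> l"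
  using theta_mono by (rule strict_mono_less_eq)

text \<open>Going n periods to either side of \<theta> 0 covers both s and t, which confines the
  indices to [-pn, pn]. As \<open>card\<close> is 0 on infinite sets, finiteness makes the exponent
  in \<open>transU\<close> a genuine count.\<close>

lemma finite_thetas: "finite {k. s \<le> \<theta> k \<and> \<theta> k < t}"
proof -
  obtain n where n: "real n * T > max \<bar>s - \<theta> 0\<bar> \<bar>t - \<theta> 0\<bar>"
    using T_pos ex_less_of_nat_mult by blast
  have up: "\<theta> (int p * int n) = \<theta> 0 + real n * T"
    using theta_shift[of 0 n] by simp
  \<comment> \<open>\<open>theta_shift\<close> only moves forward, so it is started from the
    negative index.\<close>
  have dn: "\<theta> (- (int p * int n)) = \<theta> 0 - real n * T"
    using theta_shift[of "- (int p * int n)" n] by simp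
  have "{k. s \<le> \<theta> k \<and> \<theta> k < t} \<subseteq> {- (int p * int n)..int p * int n}"
  proof
    fix k assume k: "k \<in> {k. s \<le> \<theta> k \<and> \<theta> k < t}"
    have "\<theta> (- (int p * int n)) < \<theta> k" "\<theta> k < \<theta> (int p * int n)"
      using k n up dn by auto
    then show "k \<in> {- (int p * int n)..int p * int n}"
      by (simp add: theta_less_iff)
  qed
  then show ?thesis by (rule finite_subset) simp
qed

text \<open>The gap lengths are p-periodic in k, so their minimum over one period is a positive
  uniform lower bound.\<close>

lemma theta_gap: "\<exists>\<mu>>0. \<forall>k. \<theta> k + \<mu> \<le> \<theta> (k + 1)"
proof -
  define S where "S = (\<lambda>k. \<theta> (k + 1) - \<theta> k) ` {0..<int p}"
  have S: "finite S" "S \<noteq> {}" using p_pos by (auto simp: S_def)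
  have "Min S > 0"
    using S by (auto simp: S_def theta_less_iff)
  moreover have "\<theta> k + Min S \<le> \<theta> (k + 1)" for k
  proof -
    define m where "m = k mod int p"
    have m: "m \<in> {0..<int p}" using p_pos by (simp add: m_def)
    \<comment> \<open>Shifts are by a natural number of periods, so k and its residue m are compared
      in whichever direction is nonnegative.\<close>
    obtain j where "k = m + int p * int j \<or> m = k + int p * int j"
    proof (cases "k div int p \<ge> 0")
      case True
      then show ?thesis
        using that[of "nat (k div int p)"] by (simp add: m_def)
    next
      case False
      have "m = k - int p * (k div int p)" by (simp add: m_def minus_mult_div_eq_mod)
      then show ?thesis
        using that[of "nat (- (k div int p))"] False by (simp add: algebra_simps)
    qed
    then have "\<theta> (k + 1) - \<theta> k = \<theta> (m + 1) - \<theta> m"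
      using theta_shift[of m j] theta_shift[of k j] theta_shift[of "m + 1" j]
        theta_shift[of "k + 1" j]
      by (auto simp: algebra_simps)
    moreover have "Min S \<le> \<theta> (m + 1) - \<theta> m"
      using m S(1) by (auto simp: S_def intro!: Min_le)
    ultimately show ?thesis by simp
  qed
  ultimately show ?thesis by blast
qed

text \<open>Indices are grouped into blocks of p, counted back from the last jump k0 before t. Jumps
  in block j lie at least j periods before t and contribute at most a^j each, which leaves p times a
  geometric series.\<close>

lemma sum_exp_thetas_le:
  "(\<Sum>k | s \<le> \<theta> k \<and> \<theta> k < t. exp (- \<omega> * (t - \<theta> k))) \<le> real p / (1 - exp (- \<omega> * T))"
proof -
  define a where "a = exp (- \<omega> * T)"
  have a: "0 < a" "a < 1"
    using T_pos omega_pos by (simp_all add: a_def)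
  define S where "S = {k. s \<le> \<theta> k \<and> \<theta> k < t}"
  have fin: "finite S" unfolding S_def by (rule finite_thetas)
  show ?thesis
  proof (cases "S = {}")
    case True
    then show ?thesis using a unfolding S_def[symmetric] a_def[symmetric] by simp
  next
    case False
    define k0 where "k0 = Max S"
    have k0: "k0 \<in> S" "\<And>k. k \<in> S \<Longrightarrow> k \<le> k0"
      using False fin by (auto simp: k0_def)
    define I where "I = (\<lambda>k. nat (k0 - k)) ` S"
    have term_le: "exp (- \<omega> * (t - \<theta> k)) \<le> a ^ (nat (k0 - k) div p)" if "k \<in> S" for k
    proof -
      define j where "j = nat (k0 - k) div p"
      have "p * j \<le> nat (k0 - k)" by (simp add: j_def)
      then have "int (p * j) \<le> k0 - k" using k0(2)[OF that] by linarith
      then have "k + int p * int j \<le> k0" by simp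
      then have "\<theta> k + real j * T \<le> \<theta> k0"
        by (metis theta_shift theta_le_iff)
      also have "\<theta> k0 < t" using k0(1) by (simp add: S_def)
      finally have "real j * T \<le> t - \<theta> k" by simp
      then have "\<omega> * (real j * T) \<le> \<omega> * (t - \<theta> k)"
        using omega_pos by (intro mult_left_mono) auto
      then have "exp (- \<omega> * (t - \<theta> k)) \<le> exp (real j * (- \<omega> * T))"
        by (simp add: algebra_simps)
      also have "\<dots> = a ^ j" by (simp only: a_def exp_of_nat_mult)
      finally show ?thesis by (simp add: j_def)
    qed
    obtain m where m: "I \<subseteq> {..<m}"
      using finite_nat_iff_bounded[of I] fin by (auto simp: I_def)
    \<comment> \<open>The index set is enlarged to m full blocks; the added terms are
      nonnegative.\<close>
    have "m \<le> m * p" using p_pos by simp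
    with m have I_sub: "I \<subseteq> {..<m * p}"
      by (meson lessThan_iff less_le_trans subset_iff)
    have "(\<Sum>k\<in>S. exp (- \<omega> * (t - \<theta> k))) \<le> (\<Sum>k\<in>S. a ^ (nat (k0 - k) div p))"
      by (intro sum_mono term_le)
    also have "\<dots> = (\<Sum>i\<in>I. a ^ (i div p))"
      unfolding I_def by (subst sum.reindex) (auto simp: inj_on_def dest!: k0(2))
    also have "\<dots> \<le> (\<Sum>i<m * p. a ^ (i div p))"
      using I_sub a by (intro sum_mono2) auto
    also have "\<dots> = (\<Sum>j<m. \<Sum>i\<in>{j * p..<j * p + p}. a ^ (i div p))"
      by (rule sum.nat_group[symmetric])
    also have "\<dots> = (\<Sum>j<m. real p * a ^ j)"
    proof (intro sum.cong refl)
      fix j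
      have "i div p = j" if "i \<in> {j * p..<j * p + p}" for i
        using that by (intro div_nat_eqI) (auto simp: mult.commute)
      then show "(\<Sum>i\<in>{j * p..<j * p + p}. a ^ (i div p)) = real p * a ^ j"
        by simp
    qed
    also have "\<dots> = real p * (\<Sum>j<m. a ^ j)" by (simp add: sum_distrib_left)
    also have "\<dots> \<le> real p * (1 / (1 - a))"
      using a by (intro mult_left_mono) (simp_all add: sum_gp_strict divide_right_mono)
    finally show ?thesis by (simp add: S_def a_def)
  qed
qed

section \<open>Transporting solutions by the transition matrix\<close>

lemma A_mpow_commute: "mpow (mat 1 + B) c ** A = A ** mpow (mat 1 + B) c"
proof (rule mpow_commute)
  have "(mat 1 + B) ** A = mat 1 ** A + B ** A"
    by (simp add: matrix_matrix_mult_def sum.distrib vec_eq_iff distrib_right)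
  then show "(mat 1 + B) ** A = A ** (mat 1 + B)"
    by (simp add: matrix_add_ldistrib A_B_comm)
qed

text \<open>No jump separates \<sigma> from b, so the jump count is frozen and only the exponential
  depends on \<sigma>. The right end is included because a jump at b belongs to [b,t).\<close>

lemma transU_gap:
  assumes "range \<theta> \<inter> {a<..<b} = {}" and "a < \<sigma>" "\<sigma> \<le> b"
  shows "transU A B \<theta> t \<sigma>
    = mexp ((t - \<sigma>) *\<^sub>R A) ** mpow (mat 1 + B) (card {k. b \<le> \<theta> k \<and> \<theta> k < t})"
proof -
  have "{k. \<sigma> \<le> \<theta> k \<and> \<theta> k < t} = {k. b \<le> \<theta> k \<and> \<theta> k < t}"
    using assms by (fastforce simp: disjoint_iff not_less[symmetric])
  then show ?thesis by (simp add: transU_def)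
qed

lemma norm_transU_le:
  assumes "s \<le> t"
  shows "norm (transU A B \<theta> t s *v v) \<le> N * exp (- \<omega> * (t - s)) * norm v"
  using norm_matrix_vector_le[of "transU A B \<theta> t s" v] U_bound[OF assms]
  by (meson mult_right_mono norm_ge_zero order_trans)

text \<open>The bound for \<open>U(t,a+)\<close>, in which a jump at \<open>a\<close> itself is no longer counted.\<close>

lemma norm_transU_right_limit_le:
  assumes gap: "range \<theta> \<inter> {a<..<b} = {}" and ab: "a < b" "b \<le> t"
  shows "norm (mexp ((t - a) *\<^sub>R A) *v (mpow (mat 1 + B) (card {k. b \<le> \<theta> k \<and> \<theta> k < t}) *v v))
    \<le> N * exp (- \<omega> * (t - a)) * norm v"
proof -
  define M where "M = mpow (mat 1 + B) (card {k. b \<le> \<theta> k \<and> \<theta> k < t})"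
  have "continuous_on UNIV (\<lambda>\<sigma>. mexp ((t - \<sigma>) *\<^sub>R A) *v (M *v v))"
    by (intro bounded_bilinear.continuous_on[OF bounded_bilinear_matrix_vector_mult]
        continuous_on_mexp continuous_intros)
  then have "isCont (\<lambda>\<sigma>. mexp ((t - \<sigma>) *\<^sub>R A) *v (M *v v)) a"
    by (simp add: continuous_on_eq_continuous_at)
  then have lim: "((\<lambda>\<sigma>. mexp ((t - \<sigma>) *\<^sub>R A) *v (M *v v))
      \<longlongrightarrow> mexp ((t - a) *\<^sub>R A) *v (M *v v)) (at_right a)"
    by (simp add: isCont_def filterlim_at_split)
  show ?thesis
    unfolding M_def[symmetric]
  proof (rule tendsto_le)
    show "((\<lambda>\<sigma>. norm (mexp ((t - \<sigma>) *\<^sub>R A) *v (M *v v)))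
      \<longlongrightarrow> norm (mexp ((t - a) *\<^sub>R A) *v (M *v v))) (at_right a)"
      using lim by (rule tendsto_norm)
    show "((\<lambda>\<sigma>. N * exp (- \<omega> * (t - \<sigma>)) * norm v) \<longlongrightarrow> N * exp (- \<omega> * (t - a)) * norm v)
      (at_right a)"
      by (intro tendsto_intros)
    have "norm (mexp ((t - \<sigma>) *\<^sub>R A) *v (M *v v)) \<le> N * exp (- \<omega> * (t - \<sigma>)) * norm v"
      if "a < \<sigma>" "\<sigma> < b" for \<sigma>
      using norm_transU_le[of \<sigma> t v] transU_gap[OF gap, of \<sigma> t] that ab
      by (auto simp: M_def matrix_vector_mul_assoc)
    then show "\<forall>\<^sub>F \<sigma> in at_right a.
        norm (mexp ((t - \<sigma>) *\<^sub>R A) *v (M *v v)) \<le> N * exp (- \<omega> * (t - \<sigma>)) * norm v"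
      using ab(1) by (auto simp: eventually_at_right_field)
  qed simp
qed

text \<open>Between two jump moments \<open>\<sigma> \<mapsto> U(t,\<sigma>) y(\<sigma>)\<close> is differentiable with derivative
  \<open>U(t,\<sigma>) h(\<sigma>)\<close>, so the mean value inequality replaces the variation of constants formula.\<close>

lemma transport_gap_le:
  assumes sol: "linear_imp_sol A B \<theta> h w y"
    and gap: "range \<theta> \<inter> {a<..<b} = {}" and ab: "a < b" "b \<le> t"
    and ly: "(y \<longlongrightarrow> ly) (at_right a)"
    and h: "\<And>\<tau>. a < \<tau> \<Longrightarrow> \<tau> < b \<Longrightarrow> norm (h \<tau>) \<le> C"
  defines "M \<equiv> mpow (mat 1 + B) (card {k. b \<le> \<theta> k \<and> \<theta> k < t})"
  shows "norm (mexp ((t - b) *\<^sub>R A) *v (M *v y b) - mexp ((t - a) *\<^sub>R A) *v (M *v ly))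
    \<le> C * N / \<omega> * exp (- \<omega> * (t - b)) - C * N / \<omega> * exp (- \<omega> * (t - a))"
proof -
  \<comment> \<open>At a, where y is only left-continuous, the value is replaced by the right limit,
    giving the continuity on the closed interval that the mean value inequality needs.\<close>
  define z where "z \<sigma> = (if \<sigma> = a then ly else y \<sigma>)" for \<sigma>
  define Z where "Z \<sigma> = mexp ((t - \<sigma>) *\<^sub>R A) *v (M *v z \<sigma>)" for \<sigma>
  have der_y: "(y has_vector_derivative (A *v y \<sigma> + h \<sigma>)) (at \<sigma>)" if "a < \<sigma>" "\<sigma> < b" for \<sigma>
  proof -
    have "\<sigma> \<notin> range \<theta>" using gap that by auto
    then show ?thesis using sol by (simp add: linear_imp_sol_def)
  qed
  have z_cont: "continuous_on {a..b} z"
    unfolding continuous_on_def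
  proof
    fix \<sigma> assume \<sigma>: "\<sigma> \<in> {a..b}"
    consider "\<sigma> = a" | "\<sigma> = b" | "a < \<sigma>" "\<sigma> < b" using \<sigma> by fastforce
    then show "(z \<longlongrightarrow> z \<sigma>) (at \<sigma> within {a..b})"
    proof cases
      case 1
      have "(y \<longlongrightarrow> ly) (at a within {a..b})"
        using ly ab by (simp add: at_within_Icc_at_right)
      then have "(z \<longlongrightarrow> ly) (at a within {a..b})"
        by (rule Lim_transform_within[where d = 1]) (auto simp: z_def)
      then show ?thesis using 1 by (simp add: z_def)
    next
      case 2
      have "(y \<longlongrightarrow> y b) (at b within {a..b})"
        using linear_imp_sol_left_continuous[OF sol]
        by (rule tendsto_within_subset) auto
      then have "(z \<longlongrightarrow> y b) (at b within {a..b})"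
        by (rule Lim_transform_within[where d = "b - a"]) (use ab in \<open>auto simp: z_def dist_real_def\<close>)
      then show ?thesis using 2 ab by (simp add: z_def)
    next
      case 3
      have "(y \<longlongrightarrow> y \<sigma>) (at \<sigma> within {a..b})"
        using has_vector_derivative_continuous[OF der_y[OF 3]]
        by (simp add: continuous_within tendsto_within_subset[of _ _ _ UNIV])
      then have "(z \<longlongrightarrow> y \<sigma>) (at \<sigma> within {a..b})"
        by (rule Lim_transform_within[where d = "\<sigma> - a"]) (use 3 in \<open>auto simp: z_def dist_real_def\<close>)
      then show ?thesis using 3 by (simp add: z_def)
    qed
  qed
  \<comment> \<open>The comparison function is the antiderivative of C N exp(-\<omega>(t-\<sigma>)),
    which bounds the norm of U(t,\<sigma>) h(\<sigma>).\<close>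
  have "norm (Z b - Z a)
    \<le> C * N / \<omega> * exp (- \<omega> * (t - b)) - C * N / \<omega> * exp (- \<omega> * (t - a))"
  proof (rule differentiable_bound_general
      [where f' = "\<lambda>\<sigma>. mexp ((t - \<sigma>) *\<^sub>R A) *v (M *v h \<sigma>)"
        and \<phi>' = "\<lambda>\<sigma>. C * N * exp (- \<omega> * (t - \<sigma>))"])
    show "continuous_on {a..b} Z"
      unfolding Z_def
      by (intro bounded_bilinear.continuous_on[OF bounded_bilinear_matrix_vector_mult]
        continuous_on_mexp continuous_intros z_cont)
    show "continuous_on {a..b} (\<lambda>\<sigma>. C * N / \<omega> * exp (- \<omega> * (t - \<sigma>)))"
      by (intro continuous_intros)
    fix \<sigma> assume \<sigma>: "a < \<sigma>" "\<sigma> < b"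
    show "((\<lambda>\<sigma>. C * N / \<omega> * exp (- \<omega> * (t - \<sigma>))) has_vector_derivative
        C * N * exp (- \<omega> * (t - \<sigma>))) (at \<sigma>)"
      using omega_pos
      by (auto intro!: derivative_eq_intros simp flip: has_real_derivative_iff_has_vector_derivative)
    have "((\<lambda>\<sigma>. t - \<sigma>) has_vector_derivative - 1) (at \<sigma>)"
      by (auto intro!: derivative_eq_intros simp flip: has_real_derivative_iff_has_vector_derivative)
    from vector_diff_chain_at[OF this mexp_has_vector_derivative]
    have E': "((\<lambda>\<sigma>. mexp ((t - \<sigma>) *\<^sub>R A)) has_vector_derivative
        - (mexp ((t - \<sigma>) *\<^sub>R A) ** A)) (at \<sigma>)"
      by (simp add: o_def)
    have "((\<lambda>\<sigma>. M *v y \<sigma>) has_vector_derivative M *v (A *v y \<sigma> + h \<sigma>)) (at \<sigma>)"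
      by (rule bounded_linear.has_vector_derivative[OF _ der_y[OF \<sigma>]]) simp
    from bounded_bilinear.has_vector_derivative[OF bounded_bilinear_matrix_vector_mult E' this]
    have "((\<lambda>\<sigma>. mexp ((t - \<sigma>) *\<^sub>R A) *v (M *v y \<sigma>)) has_vector_derivative
        mexp ((t - \<sigma>) *\<^sub>R A) *v (M *v (A *v y \<sigma> + h \<sigma>))
          + - (mexp ((t - \<sigma>) *\<^sub>R A) ** A) *v (M *v y \<sigma>)) (at \<sigma>)" .
    \<comment> \<open>Moving \<open>A\<close> past the jump factors lets the term coming from y'
      cancel the one from the derivative of the exponential; only the forcing survives.\<close>
    moreover have "M *v (A *v y \<sigma>) = A *v (M *v y \<sigma>)"
      by (simp add: M_def A_mpow_commute matrix_vector_mul_assoc)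
    moreover have "- (mexp ((t - \<sigma>) *\<^sub>R A) ** A) *v (M *v y \<sigma>)
        = - (mexp ((t - \<sigma>) *\<^sub>R A) *v (A *v (M *v y \<sigma>)))"
      using matrix_vector_mult_diff_rdistrib[of 0 "mexp ((t - \<sigma>) *\<^sub>R A) ** A" "M *v y \<sigma>"]
      by (simp flip: matrix_vector_mul_assoc)
    ultimately have "((\<lambda>\<sigma>. mexp ((t - \<sigma>) *\<^sub>R A) *v (M *v y \<sigma>)) has_vector_derivative
        mexp ((t - \<sigma>) *\<^sub>R A) *v (M *v h \<sigma>)) (at \<sigma>)"
      by (simp add: matrix_vector_right_distrib)
    then show "(Z has_vector_derivative mexp ((t - \<sigma>) *\<^sub>R A) *v (M *v h \<sigma>)) (at \<sigma>)"
      by (rule has_vector_derivative_transform_within_open[where S = "{a<..<b}"])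
        (use \<sigma> in \<open>auto simp: Z_def z_def\<close>)
    have "mexp ((t - \<sigma>) *\<^sub>R A) *v (M *v h \<sigma>) = transU A B \<theta> t \<sigma> *v h \<sigma>"
      using transU_gap[OF gap, of \<sigma> t] \<sigma> by (auto simp: M_def matrix_vector_mul_assoc)
    then have "norm (mexp ((t - \<sigma>) *\<^sub>R A) *v (M *v h \<sigma>)) \<le> N * exp (- \<omega> * (t - \<sigma>)) * norm (h \<sigma>)"
      using norm_transU_le[of \<sigma> t "h \<sigma>"] \<sigma> ab by simp
    also have "\<dots> \<le> N * exp (- \<omega> * (t - \<sigma>)) * C"
      using h[OF \<sigma>] N_pos by (intro mult_left_mono) auto
    finally show "norm (mexp ((t - \<sigma>) *\<^sub>R A) *v (M *v h \<sigma>)) \<le> C * N * exp (- \<omega> * (t - \<sigma>))"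
      by (simp add: mult_ac)
  qed (rule ab)
  then show ?thesis using ab by (simp add: Z_def z_def)
qed

text \<open>Telescoping of \<tau> -> U(t,\<tau>) y(\<tau>): gap contributions are differences of one
  antiderivative, and the jump at \<theta> k adds U(t,\<theta> k+) w(k). The induction removes the
  last jump before \<tau>; keeping t separate from \<tau> leaves the transported quantity unchanged
  meanwhile.\<close>

lemma transport_le:
  assumes sol: "linear_imp_sol A B \<theta> h w y"
    and "s \<le> \<tau>" "\<tau> \<le> t"
    and h: "\<And>\<sigma>. s \<le> \<sigma> \<Longrightarrow> \<sigma> \<le> t \<Longrightarrow> norm (h \<sigma>) \<le> C"
    and w: "\<And>k. s \<le> \<theta> k \<Longrightarrow> \<theta> k < t \<Longrightarrow> norm (w k) \<le> D"
  shows "norm (transU A B \<theta> t \<tau> *v y \<tau> - transU A B \<theta> t s *v y s)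
    \<le> C * N / \<omega> * exp (- \<omega> * (t - \<tau>)) - C * N / \<omega> * exp (- \<omega> * (t - s))
      + D * N * (\<Sum>k | s \<le> \<theta> k \<and> \<theta> k < \<tau>. exp (- \<omega> * (t - \<theta> k)))"
  using assms(2,3)
proof (induction "card {k. s \<le> \<theta> k \<and> \<theta> k < \<tau>}" arbitrary: \<tau>)
  case 0
  then have none: "{k. s \<le> \<theta> k \<and> \<theta> k < \<tau>} = {}"
    using finite_thetas by simp
  show ?case
  proof (cases "s = \<tau>")
    case True
    have "{k. \<tau> \<le> \<theta> k \<and> \<theta> k < \<tau>} = {}" by auto
    then have "(\<Sum>k | \<tau> \<le> \<theta> k \<and> \<theta> k < \<tau>. exp (- \<omega> * (t - \<theta> k))) = 0"
      by (simp only: sum.empty)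
    with True show ?thesis by simp
  next
    case False
    then have st: "s < \<tau>" using 0 by simp
    have gap: "range \<theta> \<inter> {s<..<\<tau>} = {}"
      using none by force
    \<comment> \<open>A jump at s itself would have been counted, so y is continuous at s and its
      right limit is y(s).\<close>
    have "s \<notin> range \<theta>" using none st by force
    then have "(y has_vector_derivative (A *v y s + h s)) (at s)"
      using sol by (simp add: linear_imp_sol_def)
    then have "isCont y s"
      by (rule has_vector_derivative_continuous)
    then have ly: "(y \<longlongrightarrow> y s) (at_right s)"
      by (simp add: isCont_def filterlim_at_split)
    have "{k. s \<le> \<theta> k \<and> \<theta> k < t} = {k. \<tau> \<le> \<theta> k \<and> \<theta> k < t}"
      using none 0 by force
    then have "transU A B \<theta> t s *v y s = mexp ((t - s) *\<^sub>R A) *v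
        (mpow (mat 1 + B) (card {k. \<tau> \<le> \<theta> k \<and> \<theta> k < t}) *v y s)"
      by (simp add: transU_def matrix_vector_mul_assoc)
    moreover have "transU A B \<theta> t \<tau> *v y \<tau> = mexp ((t - \<tau>) *\<^sub>R A) *v
        (mpow (mat 1 + B) (card {k. \<tau> \<le> \<theta> k \<and> \<theta> k < t}) *v y \<tau>)"
      by (simp add: transU_def matrix_vector_mul_assoc)
    moreover have "norm (h \<sigma>) \<le> C" if "s < \<sigma>" "\<sigma> < \<tau>" for \<sigma>
      using h that 0 by simp
    ultimately show ?thesis
      using transport_gap_le[OF sol gap st 0(3) ly, of C] by (simp only: none sum.empty) simp
  qed
next
  case (Suc n)
  define S where "S = {k. s \<le> \<theta> k \<and> \<theta> k < \<tau>}"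
  have S: "finite S" "card S = Suc n"
    using Suc.hyps(2) finite_thetas by (auto simp: S_def)
  then have "S \<noteq> {}" by auto
  define k where "k = Max S"
  have k: "k \<in> S" "\<And>j. j \<in> S \<Longrightarrow> j \<le> k"
    using S \<open>S \<noteq> {}\<close> by (auto simp: k_def)
  have sk: "s \<le> \<theta> k" "\<theta> k < \<tau>" using k(1) by (auto simp: S_def)
  have "\<theta> j < \<theta> k \<longleftrightarrow> \<theta> j < \<tau> \<and> j \<noteq> k" if "s \<le> \<theta> j" for j
    using k(2)[of j] sk that less_trans[of "\<theta> j" "\<theta> k" \<tau>]
    by (auto simp: S_def theta_less_iff)
  then have "{j. s \<le> \<theta> j \<and> \<theta> j < \<theta> k} = S - {k}"
    by (auto simp: S_def)
  then have S_eq: "S = insert k {j. s \<le> \<theta> j \<and> \<theta> j < \<theta> k}"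
    and card_eq: "card {j. s \<le> \<theta> j \<and> \<theta> j < \<theta> k} = n"
    using k(1) S by auto
  have gap: "range \<theta> \<inter> {\<theta> k<..<\<tau>} = {}"
  proof -
    have "\<not> (\<theta> k < \<theta> j \<and> \<theta> j < \<tau>)" for j
      using k(2)[of j] sk theta_le_iff[of j k] by (auto simp: S_def)
    then show ?thesis by auto
  qed
  have ly: "(y \<longlongrightarrow> y (\<theta> k) + B *v y (\<theta> k) + w k) (at_right (\<theta> k))"
    using sol by (simp add: linear_imp_sol_def)
  define M where "M = mpow (mat 1 + B) (card {j. \<tau> \<le> \<theta> j \<and> \<theta> j < t})"
  \<comment> \<open>U(t,\<theta> k) counts the jump at \<theta> k while \<open>M\<close> does not,
    hence exactly one extra factor I + B.\<close>
  have "{j. \<theta> k \<le> \<theta> j \<and> \<theta> j < t} = insert k {j. \<tau> \<le> \<theta> j \<and> \<theta> j < t}"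
  proof -
    have "\<theta> k \<le> \<theta> j \<longleftrightarrow> j = k \<or> \<tau> \<le> \<theta> j" for j
    proof -
      have "\<theta> j \<notin> {\<theta> k<..<\<tau>}" using gap by blast
      moreover have "\<theta> j = \<theta> k \<longleftrightarrow> j = k" by (simp add: order_eq_iff theta_le_iff)
      ultimately show ?thesis using sk by auto
    qed
    moreover have "\<theta> k < t" using sk Suc.prems by simp
    ultimately show ?thesis by auto
  qed
  then have "card {j. \<theta> k \<le> \<theta> j \<and> \<theta> j < t} = Suc (card {j. \<tau> \<le> \<theta> j \<and> \<theta> j < t})"
    using sk finite_thetas by simp
  then have Uk: "transU A B \<theta> t (\<theta> k) = mexp ((t - \<theta> k) *\<^sub>R A) ** (M ** (mat 1 + B))"
    unfolding transU_def M_def by (simp only: mpow_Suc_right)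
  let ?E = "mexp ((t - \<theta> k) *\<^sub>R A)"
  let ?y1 = "y (\<theta> k) + B *v y (\<theta> k) + w k"
  \<comment> \<open>The factor I + B of the jump condition is absorbed into U(t,\<theta> k), so the
    transported solution jumps only by the image of \<open>w k\<close>.\<close>
  have jump: "?E *v (M *v ?y1) = transU A B \<theta> t (\<theta> k) *v y (\<theta> k) + ?E *v (M *v w k)"
    by (simp add: Uk matrix_vector_right_distrib matrix_vector_mult_add_rdistrib
        flip: matrix_vector_mul_assoc)
  have wk: "norm (?E *v (M *v w k)) \<le> D * N * exp (- \<omega> * (t - \<theta> k))"
  proof -
    have "norm (?E *v (M *v w k)) \<le> N * exp (- \<omega> * (t - \<theta> k)) * norm (w k)"
      unfolding M_def using gap sk Suc.prems by (intro norm_transU_right_limit_le) auto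
    also have "\<dots> \<le> N * exp (- \<omega> * (t - \<theta> k)) * D"
      using w[of k] sk Suc.prems N_pos by (intro mult_left_mono) auto
    finally show ?thesis by (simp add: mult_ac)
  qed
  have piece: "norm (transU A B \<theta> t \<tau> *v y \<tau> - ?E *v (M *v ?y1))
    \<le> C * N / \<omega> * exp (- \<omega> * (t - \<tau>)) - C * N / \<omega> * exp (- \<omega> * (t - \<theta> k))"
  proof -
    have "transU A B \<theta> t \<tau> *v y \<tau> = mexp ((t - \<tau>) *\<^sub>R A) *v (M *v y \<tau>)"
      by (simp add: transU_def M_def matrix_vector_mul_assoc)
    moreover have "norm (h \<sigma>) \<le> C" if "\<theta> k < \<sigma>" "\<sigma> < \<tau>" for \<sigma>
      using h that Suc.prems sk by simp
    ultimately show ?thesis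
      using transport_gap_le[OF sol gap sk(2) Suc.prems(2) ly, of C] by (simp add: M_def)
  qed
  have IH: "norm (transU A B \<theta> t (\<theta> k) *v y (\<theta> k) - transU A B \<theta> t s *v y s)
    \<le> C * N / \<omega> * exp (- \<omega> * (t - \<theta> k)) - C * N / \<omega> * exp (- \<omega> * (t - s))
      + D * N * (\<Sum>j | s \<le> \<theta> j \<and> \<theta> j < \<theta> k. exp (- \<omega> * (t - \<theta> j)))"
    using sk Suc.prems card_eq by (intro Suc.hyps(1)) auto
  have sum_eq: "(\<Sum>j\<in>S. exp (- \<omega> * (t - \<theta> j))) = exp (- \<omega> * (t - \<theta> k))
      + (\<Sum>j | s \<le> \<theta> j \<and> \<theta> j < \<theta> k. exp (- \<omega> * (t - \<theta> j)))"
    unfolding S_eq using finite_thetas by (subst sum.insert) auto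
  let ?U = "\<lambda>\<sigma>. transU A B \<theta> t \<sigma> *v y \<sigma>"
  have split: "?U \<tau> - ?U s = (?U \<tau> - ?E *v (M *v ?y1)) + ?E *v (M *v w k) + (?U (\<theta> k) - ?U s)"
    unfolding jump by simp
  have "norm (?U \<tau> - ?U s) \<le> norm (?U \<tau> - ?E *v (M *v ?y1)) + norm (?E *v (M *v w k))
      + norm (?U (\<theta> k) - ?U s)"
    unfolding split by (intro order_trans[OF norm_triangle_ineq] add_right_mono norm_triangle_ineq)
  with piece wk IH show ?case
    unfolding S_def[symmetric] sum_eq distrib_left by linarith
qed

text \<open>The case \<tau> = t of \<open>transport_le\<close>, where U(t,t) = I. Forcing and jump
  contributions are bounded independently of the window length.\<close>

theorem linear_imp_sol_bound:
  assumes sol: "linear_imp_sol A B \<theta> h w y" and "s \<le> t"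
    and h: "\<And>\<sigma>. s \<le> \<sigma> \<Longrightarrow> \<sigma> \<le> t \<Longrightarrow> norm (h \<sigma>) \<le> C"
    and w: "\<And>k. s \<le> \<theta> k \<Longrightarrow> \<theta> k < t \<Longrightarrow> norm (w k) \<le> D"
    and "C \<ge> 0" "D \<ge> 0"
  shows "norm (y t) \<le> N * exp (- \<omega> * (t - s)) * norm (y s)
    + N * (C / \<omega> + real p * D / (1 - exp (- \<omega> * T)))"
proof -
  let ?S = "\<Sum>k | s \<le> \<theta> k \<and> \<theta> k < t. exp (- \<omega> * (t - \<theta> k))"
  have "card {k. t \<le> \<theta> k \<and> \<theta> k < t} = 0" by (subst card_eq_0_iff) auto
  then have "transU A B \<theta> t t = mat 1" by (simp add: transU_def mexp_zero)
  then have "norm (y t - transU A B \<theta> t s *v y s)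
    \<le> C * N / \<omega> - C * N / \<omega> * exp (- \<omega> * (t - s)) + D * N * ?S"
    using transport_le[OF sol \<open>s \<le> t\<close> order_refl h w] by simp
  also have "\<dots> \<le> C * N / \<omega> + D * N * (real p / (1 - exp (- \<omega> * T)))"
  proof -
    have "0 \<le> C * N / \<omega> * exp (- \<omega> * (t - s))"
      using \<open>C \<ge> 0\<close> N_pos omega_pos by simp
    moreover have "D * N * ?S \<le> D * N * (real p / (1 - exp (- \<omega> * T)))"
      using \<open>D \<ge> 0\<close> N_pos by (intro mult_left_mono sum_exp_thetas_le) auto
    ultimately show ?thesis by linarith
  qed
  also have "\<dots> = N * (C / \<omega> + real p * D / (1 - exp (- \<omega> * T)))"
    by (simp add: algebra_simps)
  finally show ?thesis
    using norm_transU_le[OF \<open>s \<le> t\<close>, of "y s"]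
      norm_triangle_ineq2[of "y t" "transU A B \<theta> t s *v y s"] by linarith
qed

end

subsection \<open>Differential inequalities\<close>

lemma norm_diff_le_of_vector_derivative:
  fixes f :: "real \<Rightarrow> 'a::real_normed_vector"
  assumes "a \<le> b"
    and der: "\<And>\<tau>. a \<le> \<tau> \<Longrightarrow> \<tau> \<le> b \<Longrightarrow> (f has_vector_derivative f' \<tau>) (at \<tau>)"
    and bnd: "\<And>\<tau>. a \<le> \<tau> \<Longrightarrow> \<tau> \<le> b \<Longrightarrow> norm (f' \<tau>) \<le> C"
  shows "norm (f b - f a) \<le> C * (b - a)"
proof (cases "a = b")
  case False
  with \<open>a \<le> b\<close> have "a < b" by simp
  have "norm (f b - f a) \<le> C * b - C * a"
  proof (rule differentiable_bound_general[OF \<open>a < b\<close>])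
    show "continuous_on {a..b} f"
      by (rule continuous_on_vector_derivative)
        (auto intro: has_vector_derivative_at_within der)
    show "continuous_on {a..b} (\<lambda>\<tau>. C * \<tau>)"
      by (intro continuous_intros)
    show "((\<lambda>\<tau>. C * \<tau>) has_vector_derivative C) (at \<tau>)" for \<tau>
      by (auto intro!: derivative_eq_intros simp flip: has_real_derivative_iff_has_vector_derivative)
  qed (auto intro: der bnd)
  then show ?thesis by (simp add: algebra_simps)
qed simp

text \<open>The derivative of |z|^2 is at least -2L|z|^2, so |z|^2 exp(2L\<tau>) is nondecreasing.
  Squaring avoids the nondifferentiability of the norm at 0.\<close>

lemma backward_gronwall:
  fixes x y :: "real \<Rightarrow> 'a::real_inner"
  assumes "s \<le> t"
    and x: "\<And>\<tau>. (x has_vector_derivative x' \<tau>) (at \<tau>)"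
    and y: "\<And>\<tau>. (y has_vector_derivative y' \<tau>) (at \<tau>)"
    and lip: "\<And>\<tau>. norm (x' \<tau> - y' \<tau>) \<le> L * norm (x \<tau> - y \<tau>)"
  shows "norm (x s - y s) \<le> exp (L * (t - s)) * norm (x t - y t)"
proof -
  define z where "z \<tau> = x \<tau> - y \<tau>" for \<tau>
  define u where "u \<tau> = (z \<tau> \<bullet> z \<tau>) * exp (2 * L * \<tau>)" for \<tau>
  have "u s \<le> u t"
  proof (rule DERIV_nonneg_imp_nondecreasing[OF \<open>s \<le> t\<close>])
    fix \<tau>
    define z' where "z' = x' \<tau> - y' \<tau>"
    have "(z has_vector_derivative z') (at \<tau>)"
      unfolding z_def z'_def by (intro has_vector_derivative_diff x y)
    from bounded_bilinear.has_vector_derivative[OF bounded_bilinear_inner this this]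
    have "((\<lambda>\<tau>. z \<tau> \<bullet> z \<tau>) has_real_derivative 2 * (z \<tau> \<bullet> z')) (at \<tau>)"
      by (simp add: has_real_derivative_iff_has_vector_derivative inner_commute)
    then have "(u has_real_derivative
        (2 * (z \<tau> \<bullet> z') + 2 * L * (z \<tau> \<bullet> z \<tau>)) * exp (2 * L * \<tau>)) (at \<tau>)"
      unfolding u_def by (auto intro!: derivative_eq_intros simp: algebra_simps)
    moreover have "0 \<le> 2 * (z \<tau> \<bullet> z') + 2 * L * (z \<tau> \<bullet> z \<tau>)"
    proof -
      have "\<bar>z \<tau> \<bullet> z'\<bar> \<le> norm (z \<tau>) * norm z'"
        by (rule Cauchy_Schwarz_ineq2)
      also have "\<dots> \<le> norm (z \<tau>) * (L * norm (z \<tau>))"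
        unfolding z_def z'_def by (intro mult_left_mono lip) simp
      also have "\<dots> = L * (z \<tau> \<bullet> z \<tau>)"
        by (simp add: power2_norm_eq_inner[symmetric] power2_eq_square)
      finally show ?thesis by linarith
    qed
    ultimately show "\<exists>D. (u has_real_derivative D) (at \<tau>) \<and> 0 \<le> D"
      by (meson exp_ge_zero mult_nonneg_nonneg)
  qed
  then have "(norm (z s) * exp (L * s))\<^sup>2 \<le> (norm (z t) * exp (L * t))\<^sup>2"
    by (simp add: u_def power_mult_distrib power2_norm_eq_inner mult.assoc flip: exp_double)
  then have "norm (z s) * exp (L * s) \<le> norm (z t) * exp (L * t)"
    by (rule power2_le_imp_le) simp
  then show ?thesis
    by (simp add: z_def right_diff_distrib exp_diff field_simps)
qed

lemma periodic_int_shift: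
  fixes F :: "real \<Rightarrow> 'a"
  assumes per: "\<And>t. F (t + T) = F t"
  shows "F (t + of_int n * T) = F t"
proof -
  have nat: "F (t + real m * T) = F t" for m t
  proof (induction m)
    case (Suc m)
    then show ?case using per[of "t + real m * T"] by (simp add: algebra_simps)
  qed simp
  show ?thesis
  proof (cases "n \<ge> 0")
    case True
    then show ?thesis using nat[of t "nat n"] by simp
  next
    case False
    then show ?thesis using nat[of "t + of_int n * T" "nat (- n)"] by simp
  qed
qed

text \<open>Subtracting whole periods brings t into [0,T], and a continuous function is bounded on
  the compact product with K.\<close>

lemma periodic_bounded_on_compact:
  fixes F :: "real \<Rightarrow> 'a::topological_space \<Rightarrow> 'b::real_normed_vector"
  assumes "T > 0" and cont: "continuous_on UNIV (\<lambda>(t, x). F t x)"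
    and per: "\<And>t x. F (t + T) x = F t x" and "compact K"
  shows "\<exists>M>0. \<forall>t. \<forall>x\<in>K. norm (F t x) \<le> M"
proof -
  have "compact ((\<lambda>(t, x). F t x) ` ({0..T} \<times> K))"
    by (intro compact_continuous_image continuous_on_subset[OF cont] compact_Times
        \<open>compact K\<close>) auto
  then obtain M where M: "M > 0" "\<forall>v\<in>(\<lambda>(t, x). F t x) ` ({0..T} \<times> K). norm v \<le> M"
    using compact_imp_bounded bounded_pos by blast
  have "norm (F t x) \<le> M" if "x \<in> K" for t x
  proof -
    define r where "r = t + of_int (- \<lfloor>t / T\<rfloor>) * T"
    have "r \<in> {0..T}"
      using \<open>T > 0\<close> floor_divide_lower[of T t] floor_divide_upper[of T t]
      by (simp add: r_def algebra_simps)
    moreover have "F r = F t"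
      unfolding r_def using per by (intro periodic_int_shift) auto
    ultimately show ?thesis using M(2) that by (metis (mono_tags) SigmaI case_prod_conv image_eqI)
  qed
  with M(1) show ?thesis by blast
qed

text \<open>If \<open>D\<close> stayed below \<open>\<eta>\<close>, then \<open>D(\<tau>) - (\<tau> - a) G(a)\<close> would move too little for the
  displacement \<open>(b - a) G(a)\<close> to be compensated.\<close>

lemma forced_excursion:
  fixes D :: "real \<Rightarrow> 'a::real_normed_vector"
  assumes "a < b"
    and der: "\<And>\<tau>. a \<le> \<tau> \<Longrightarrow> \<tau> \<le> b \<Longrightarrow> (D has_vector_derivative (r \<tau> + G \<tau>)) (at \<tau>)"
    and r: "\<And>\<tau>. a \<le> \<tau> \<Longrightarrow> \<tau> \<le> b \<Longrightarrow> norm (r \<tau>) \<le> c * norm (D \<tau>)"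
    and osc: "\<And>\<tau>. a \<le> \<tau> \<Longrightarrow> \<tau> \<le> b \<Longrightarrow> norm (G \<tau> - G a) \<le> \<kappa> / 2"
    and G: "norm (G a) \<ge> \<kappa>"
    and "c \<ge> 0" and \<eta>: "\<eta> * (2 + c * (b - a)) < \<kappa> / 2 * (b - a)"
  shows "\<exists>\<xi>\<in>{a..b}. norm (D \<xi>) \<ge> \<eta>"
proof (rule ccontr)
  assume "\<not> ?thesis"
  then have small: "norm (D \<tau>) < \<eta>" if "a \<le> \<tau>" "\<tau> \<le> b" for \<tau>
    using that by (auto simp: not_le)
  define E where "E \<tau> = D \<tau> - (\<tau> - a) *\<^sub>R G a" for \<tau>
  have "norm (E b - E a) \<le> (c * \<eta> + \<kappa> / 2) * (b - a)"
  proof (rule norm_diff_le_of_vector_derivative)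
    fix \<tau> assume \<tau>: "a \<le> \<tau>" "\<tau> \<le> b"
    have "((\<lambda>\<tau>. (\<tau> - a) *\<^sub>R G a) has_vector_derivative G a) (at \<tau>)"
      by (auto intro!: derivative_eq_intros)
    from has_vector_derivative_diff[OF der[OF \<tau>] this]
    show "(E has_vector_derivative (r \<tau> + (G \<tau> - G a))) (at \<tau>)"
      by (simp add: E_def[abs_def] algebra_simps)
    have "norm (r \<tau>) \<le> c * \<eta>"
      using r[OF \<tau>] mult_left_mono[OF less_imp_le[OF small[OF \<tau>]] \<open>c \<ge> 0\<close>] by linarith
    then show "norm (r \<tau> + (G \<tau> - G a)) \<le> c * \<eta> + \<kappa> / 2"
      using osc[OF \<tau>] norm_triangle_ineq[of "r \<tau>" "G \<tau> - G a"] by linarith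
  qed (use \<open>a < b\<close> in simp)
  moreover have "(b - a) *\<^sub>R G a = D b - D a - (E b - E a)"
    by (simp add: E_def algebra_simps)
  then have "norm ((b - a) *\<^sub>R G a) \<le> norm (D b) + norm (D a) + norm (E b - E a)"
    by (metis norm_triangle_ineq4 add_right_mono order_trans)
  moreover have "(b - a) * \<kappa> \<le> norm ((b - a) *\<^sub>R G a)"
    using G \<open>a < b\<close> by simp
  moreover have "norm (D a) < \<eta>" "norm (D b) < \<eta>"
    using small[of a] small[of b] \<open>a < b\<close> by simp_all
  ultimately have "(b - a) * \<kappa> < 2 * \<eta> + (c * \<eta> + \<kappa> / 2) * (b - a)"
    by linarith
  \<comment> \<open>After cancelling half of (b - a) \<kappa>, this is the reverse of the inequality
    required of \<eta>.\<close>
  with \<eta> show False by (simp add: field_simps)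
qed

subsection \<open>A priori bound and contraction\<close>

context impulsive_decay
begin

text \<open>Starting from t - n and letting n grow, the initial term dies out because y is bounded.
  The resulting bound is the same for all bounded solutions.\<close>

lemma bounded_sol_bound:
  assumes sol: "linear_imp_sol A B \<theta> h w y" and "bounded (range y)"
    and h: "\<And>t. norm (h t) \<le> C" and w: "\<And>k. norm (w k) \<le> D"
  shows "norm (y t) \<le> N * (C / \<omega> + real p * D / (1 - exp (- \<omega> * T)))"
proof -
  let ?K = "N * (C / \<omega> + real p * D / (1 - exp (- \<omega> * T)))"
  have "C \<ge> 0" using h[of 0] norm_ge_zero[of "h 0"] by linarith
  have "D \<ge> 0" using w[of 0] norm_ge_zero[of "w 0"] by linarith
  obtain m where m: "\<And>t. norm (y t) \<le> m"
    using \<open>bounded (range y)\<close> by (auto simp: bounded_iff)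
  have "norm (y t) \<le> N * exp (- \<omega>) ^ n * m + ?K" for n
  proof -
    have "norm (y t) \<le> N * exp (- \<omega> * real n) * norm (y (t - real n)) + ?K"
      using linear_imp_sol_bound[OF sol _ h w \<open>C \<ge> 0\<close> \<open>D \<ge> 0\<close>, of "t - real n" t] by simp
    also have "\<dots> \<le> N * exp (- \<omega> * real n) * m + ?K"
      using m N_pos by (intro add_right_mono mult_left_mono) auto
    also have "exp (- \<omega> * real n) = exp (- \<omega>) ^ n"
      by (metis exp_of_nat2_mult)
    finally show ?thesis .
  qed
  moreover have "(\<lambda>n. N * exp (- \<omega>) ^ n * m + ?K) \<longlonglongrightarrow> N * 0 * m + ?K"
    using omega_pos by (intro tendsto_intros LIMSEQ_realpow_zero) auto
  ultimately show ?thesis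
    using LIMSEQ_le_const[of _ "N * 0 * m + ?K" "norm (y t)"] by simp
qed

text \<open>Iterating \<open>linear_imp_sol_bound\<close> over windows of a fixed length \<open>R\<close> contracts the supremum
  of a solution by the factor \<open>q + N exp(-\<omega> R) < 1\<close> per window.\<close>

lemma small_after_long_time:
  assumes L: "Lf \<ge> 0" "Lw \<ge> 0"
    and q: "N * (Lf / \<omega> + real p * Lw / (1 - exp (- \<omega> * T))) < 1"
    and "\<delta> > 0" "H \<ge> 0"
  shows "\<exists>\<rho>\<ge>0. \<exists>\<gamma>>0. \<forall>h w y t0. linear_imp_sol A B \<theta> h w y \<longrightarrow>
    (\<forall>t. norm (y t) \<le> H) \<longrightarrow>
    (\<forall>t. t0 - \<rho> \<le> t \<longrightarrow> t \<le> t0 \<longrightarrow> norm (h t) \<le> Lf * norm (y t) + \<gamma>) \<longrightarrow>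
    (\<forall>k. norm (w k) \<le> Lw * norm (y (\<theta> k))) \<longrightarrow> norm (y t0) < \<delta>"
proof -
  define e where "e = 1 - exp (- \<omega> * T)"
  have e: "e > 0" using T_pos omega_pos by (simp add: e_def)
  define q where "q = N * (Lf / \<omega> + real p * Lw / e)"
  have q: "0 \<le> q" "q < 1"
    using q L N_pos omega_pos e by (simp_all add: q_def e_def)
  \<comment> \<open>q1 = q + (1-q)/2: the window length R is chosen so that the initial term costs
    at most the (1-q)/2.\<close>
  define q1 where "q1 = (1 + q) / 2"
  have q1: "0 < q1" "q1 < 1" using q by (simp_all add: q1_def)
  obtain n where "exp (- \<omega>) ^ n < (1 - q) / (2 * N)"
    using real_arch_pow_inv[of "(1 - q) / (2 * N)" "exp (- \<omega>)"] q N_pos omega_pos by auto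
  define R where "R = real n"
  have "exp (- \<omega> * R) = exp (- \<omega>) ^ n"
    unfolding R_def by (metis exp_of_nat2_mult)
  with \<open>exp (- \<omega>) ^ n < (1 - q) / (2 * N)\<close> have R: "N * exp (- \<omega> * R) \<le> (1 - q) / 2"
    using N_pos by (simp add: field_simps)
  have "R \<ge> 0" by (simp add: R_def)
  \<comment> \<open>After m windows the initial bound H has shrunk below \<delta>/2; H + 1 avoids
    division by zero.\<close>
  obtain m where m: "q1 ^ m < \<delta> / (2 * (H + 1))"
    using real_arch_pow_inv[of "\<delta> / (2 * (H + 1))" q1] q1 \<open>\<delta> > 0\<close> \<open>H \<ge> 0\<close> by auto
  have "q1 ^ m * H \<le> q1 ^ m * (H + 1)" using q1 by simp
  also have "\<dots> < \<delta> / 2" using m \<open>H \<ge> 0\<close> by (simp add: field_simps)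
  finally have m: "q1 ^ m * H < \<delta> / 2" .
  \<comment> \<open>Chosen so that \<delta>/2 is the fixed point of b -> q1 b + N \<gamma>/\<omega>,
    the map describing one window.\<close>
  define \<gamma> where "\<gamma> = \<delta> * \<omega> * (1 - q1) / (2 * N)"
  have "\<gamma> > 0" using \<open>\<delta> > 0\<close> omega_pos q1 N_pos by (simp add: \<gamma>_def)
  have \<gamma>: "N * (\<gamma> / \<omega>) = (1 - q1) * (\<delta> / 2)"
    using N_pos omega_pos by (simp add: \<gamma>_def field_simps)
  define \<rho> where "\<rho> = real m * R"
  have "norm (y t0) < \<delta>"
    if sol: "linear_imp_sol A B \<theta> h w y" and H: "\<And>t. norm (y t) \<le> H"
      and h: "\<And>t. t0 - \<rho> \<le> t \<Longrightarrow> t \<le> t0 \<Longrightarrow> norm (h t) \<le> Lf * norm (y t) + \<gamma>"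
      and w: "\<And>k. norm (w k) \<le> Lw * norm (y (\<theta> k))" for h w y t0
  proof -
    have "norm (y \<tau>) \<le> q1 ^ j * H + \<delta> / 2"
      if "t0 - \<rho> + real j * R \<le> \<tau>" "\<tau> \<le> t0" for j \<tau>
      using that
    proof (induction j arbitrary: \<tau>)
      case 0
      then show ?case using H[of \<tau>] \<open>\<delta> > 0\<close> by simp
    next
      case (Suc j)
      define b where "b = q1 ^ j * H + \<delta> / 2"
      have "b \<ge> 0" using q1 \<open>H \<ge> 0\<close> \<open>\<delta> > 0\<close> by (simp add: b_def)
      have start: "t0 - \<rho> + real j * R \<le> \<tau> - R" using Suc.prems by (simp add: algebra_simps)
      have b: "norm (y \<sigma>) \<le> b" if "\<tau> - R \<le> \<sigma>" "\<sigma> \<le> \<tau>" for \<sigma>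
        using Suc.IH[of \<sigma>] that start Suc.prems by (simp add: b_def)
      have "norm (y \<tau>) \<le> N * exp (- \<omega> * (\<tau> - (\<tau> - R))) * norm (y (\<tau> - R))
          + N * ((Lf * b + \<gamma>) / \<omega> + real p * (Lw * b) / (1 - exp (- \<omega> * T)))"
      proof (rule linear_imp_sol_bound[OF sol])
        fix \<sigma> assume \<sigma>: "\<tau> - R \<le> \<sigma>" "\<sigma> \<le> \<tau>"
        have "0 \<le> real j * R" using \<open>R \<ge> 0\<close> by simp
        then have "norm (h \<sigma>) \<le> Lf * norm (y \<sigma>) + \<gamma>"
          using \<sigma> start Suc.prems by (intro h) linarith+
        also have "\<dots> \<le> Lf * b + \<gamma>"
          using b[OF \<sigma>] L by (simp add: mult_left_mono)
        finally show "norm (h \<sigma>) \<le> Lf * b + \<gamma>" .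
      next
        fix k assume "\<tau> - R \<le> \<theta> k" "\<theta> k < \<tau>"
        then show "norm (w k) \<le> Lw * b"
          using w[of k] b[of "\<theta> k"] mult_left_mono[OF _ L(2)] by (meson less_imp_le order_trans)
      qed (use \<open>R \<ge> 0\<close> L \<open>b \<ge> 0\<close> \<open>\<gamma> > 0\<close> in auto)
      also have "\<dots> \<le> (1 - q) / 2 * b
          + N * ((Lf * b + \<gamma>) / \<omega> + real p * (Lw * b) / (1 - exp (- \<omega> * T)))"
        using R b[of "\<tau> - R"] \<open>R \<ge> 0\<close> \<open>b \<ge> 0\<close> N_pos q
        by (intro add_right_mono mult_mono) auto
      also have "N * ((Lf * b + \<gamma>) / \<omega> + real p * (Lw * b) / (1 - exp (- \<omega> * T)))
          = q * b + N * (\<gamma> / \<omega>)"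
        unfolding q_def e_def[symmetric] by (simp add: algebra_simps add_divide_distrib)
      also have "(1 - q) / 2 * b + (q * b + N * (\<gamma> / \<omega>)) = q1 * b + (1 - q1) * (\<delta> / 2)"
        unfolding \<gamma> by (simp add: q1_def field_simps)
      also have "\<dots> = q1 ^ Suc j * H + \<delta> / 2"
        by (simp add: b_def field_simps)
      finally show ?case .
    qed
    from this[of m t0] have "norm (y t0) \<le> q1 ^ m * H + \<delta> / 2"
      by (simp add: \<rho>_def)
    with m show ?thesis by linarith
  qed
  moreover have "\<rho> \<ge> 0" using \<open>R \<ge> 0\<close> by (simp add: \<rho>_def)
  ultimately show ?thesis using \<open>\<gamma> > 0\<close> by blast
qed

text \<open>Two adjacent open intervals of length d cannot both contain a jump, since their jumps
  would be less than 2d \<le> \<mu> apart.\<close>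

lemma jump_free_subinterval:
  assumes gap: "\<And>k. \<theta> k + \<mu> \<le> \<theta> (k + 1)" and "d > 0" "2 * d \<le> \<mu>"
  obtains \<alpha> where "a \<le> \<alpha>" "\<alpha> + d \<le> a + 2 * d" "range \<theta> \<inter> {\<alpha><..<\<alpha> + d} = {}"
proof (cases "range \<theta> \<inter> {a<..<a + d} = {}")
  case True
  then show ?thesis using that[of a] \<open>d > 0\<close> by simp
next
  case False
  then obtain k where k: "a < \<theta> k" "\<theta> k < a + d" by auto
  have "\<not> (a + d < \<theta> j \<and> \<theta> j < a + d + d)" for j
  proof
    assume j: "a + d < \<theta> j \<and> \<theta> j < a + d + d"
    then have "\<theta> k < \<theta> j" using k by linarith
    then have "\<theta> (k + 1) \<le> \<theta> j" by (simp add: theta_less_iff theta_le_iff)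
    then have "\<theta> k + \<mu> \<le> \<theta> j" using gap[of k] by linarith
    then show False using j k \<open>2 * d \<le> \<mu>\<close> by linarith
  qed
  then have "range \<theta> \<inter> {a + d<..<a + d + d} = {}" by auto
  then show ?thesis using that[of "a + d"] \<open>d > 0\<close> by simp
qed

end

subsection \<open>Replication of sensitivity\<close>

theorem theorem1:
  fixes F :: "real \<Rightarrow> real^'m \<Rightarrow> real^'m"
    and f :: "real \<Rightarrow> real^'n \<Rightarrow> real^'n"
    and g :: "real^'m \<Rightarrow> real^'n"
    and W :: "real^'n \<Rightarrow> real^'n"
    and A B :: "real^'n^'n"
    and \<theta> :: "int \<Rightarrow> real"
    and T :: real and p :: nat
    and \<Lambda> :: "(real^'m) set"
    and N \<omega> L\<^sub>F L\<^sub>f L\<^sub>1 L\<^sub>2 L\<^sub>W :: real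
    and \<phi> :: "(real \<Rightarrow> real^'m) \<Rightarrow> real \<Rightarrow> real^'n"
  assumes T_pos: "T > 0"
    and F_cont: "continuous_on UNIV (\<lambda>(t, x). F t x)"
    and F_per: "\<And>t x. F (t + T) x = F t x"
    and A_ne: "bdd_sols1 F \<noteq> {}"
    and Lambda_compact: "compact \<Lambda>"
    and Lambda_traj: "\<And>x t. x \<in> bdd_sols1 F \<Longrightarrow> x t \<in> \<Lambda>"
    and f_cont: "continuous_on UNIV (\<lambda>(t, y). f t y)"
    and g_cont: "continuous_on UNIV g"
    and W_cont: "continuous_on UNIV W"
    and f_per: "\<And>t y. f (t + T) y = f t y"
    and theta_mono: "strict_mono \<theta>"
    and p_pos: "p \<ge> 1"
    and theta_per: "\<And>k. \<theta> (k + int p) = \<theta> k + T"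
    \<comment> \<open>(A1)\<close>
    and A1_comm: "A ** B = B ** A"
    and A1_det: "det (mat 1 + B) \<noteq> 0"
    \<comment> \<open>(A2): a (complex) logarithm L = ln(I+B) commuting with A, and all eigenvalues
        of A + (p/T) ln(I+B) have negative real parts\<close>
    and A2: "\<exists>L::complex^'n^'n. mexp L = cmat (mat 1 + B) \<and> L ** cmat A = cmat A ** L \<and>
               (\<forall>\<mu> v. v \<noteq> 0 \<longrightarrow> (cmat A + (real p / T) *\<^sub>R L) *v v = \<mu> *s v \<longrightarrow> Re \<mu> < 0)"
    \<comment> \<open>the fixed constants N, \<omega> of the exponential estimate of U\<close>
    and N_pos: "N > 0" and omega_pos: "\<omega> > 0"
    and U_bound: "\<And>t s. s \<le> t \<Longrightarrow> opnorm (transU A B \<theta> t s) \<le> N * exp (- \<omega> * (t - s))"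
    \<comment> \<open>(A3)\<close>
    and A3_f: "\<exists>M\<^sub>f>0. \<forall>t y. norm (f t y) \<le> M\<^sub>f"
    and A3_W: "\<exists>M\<^sub>W>0. \<forall>y. norm (W y) \<le> M\<^sub>W"
    \<comment> \<open>(A4)\<close>
    and L_pos: "L\<^sub>F > 0" "L\<^sub>f > 0" "L\<^sub>1 > 0" "L\<^sub>2 > 0" "L\<^sub>W > 0"
    and A4_F: "\<And>t x1 x2. x1 \<in> \<Lambda> \<Longrightarrow> x2 \<in> \<Lambda> \<Longrightarrow> norm (F t x1 - F t x2) \<le> L\<^sub>F * norm (x1 - x2)"
    and A4_f: "\<And>t y1 y2. norm (f t y1 - f t y2) \<le> L\<^sub>f * norm (y1 - y2)"
    and A4_g: "\<And>x1 x2. x1 \<in> \<Lambda> \<Longrightarrow> x2 \<in> \<Lambda> \<Longrightarrow>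
                 L\<^sub>1 * norm (x1 - x2) \<le> norm (g x1 - g x2) \<and> norm (g x1 - g x2) \<le> L\<^sub>2 * norm (x1 - x2)"
    and A4_W: "\<And>y1 y2. norm (W y1 - W y2) \<le> L\<^sub>W * norm (y1 - y2)"
    \<comment> \<open>(A5)--(A7)\<close>
    and A5: "N * (L\<^sub>f / \<omega> + real p * L\<^sub>W / (1 - exp (- \<omega> * T))) < 1"
    and A6: "- \<omega> + N * L\<^sub>f + real p / T * ln (1 + N * L\<^sub>W) < 0"
    and A7: "L\<^sub>W * opnorm (matrix_inv (mat 1 + B)) < 1"
    \<comment> \<open>\<phi> x is the (unique) solution of (2) bounded on \<real>\<close>
    and phi_sol: "\<And>x. x \<in> bdd_sols1 F \<Longrightarrow> is_sol2 A B f g W \<theta> x (\<phi> x) \<and> bounded (range (\<phi> x))"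
    \<comment> \<open>sensitivity of (1)\<close>
    and sens1: "\<exists>\<epsilon>\<^sub>0>0. \<exists>\<Delta>>0. \<forall>\<delta>\<^sub>0>0. \<forall>x\<in>bdd_sols1 F. \<exists>xb\<in>bdd_sols1 F. \<exists>t\<^sub>0 J.
                  J \<subseteq> {t\<^sub>0..} \<and> interval_len_ge J \<Delta> \<and> norm (x t\<^sub>0 - xb t\<^sub>0) < \<delta>\<^sub>0 \<and>
                  (\<forall>t\<in>J. norm (x t - xb t) > \<epsilon>\<^sub>0)"
  shows "\<exists>\<epsilon>\<^sub>1>0. \<exists>\<Delta>b>0. \<forall>\<delta>\<^sub>1>0. \<forall>x\<in>bdd_sols1 F. \<exists>xb\<in>bdd_sols1 F. \<exists>t\<^sub>0 J1.
           J1 \<subseteq> {t\<^sub>0..} \<and> interval_len_ge J1 \<Delta>b \<and>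
           (\<forall>k l. \<theta> k \<in> J1 \<longrightarrow> \<theta> l \<in> J1 \<longrightarrow> k = l) \<and>
           norm (\<phi> x t\<^sub>0 - \<phi> xb t\<^sub>0) < \<delta>\<^sub>1 \<and>
           (\<forall>t\<in>J1. norm (\<phi> x t - \<phi> xb t) > \<epsilon>\<^sub>1)"
proof -
  interpret impulsive_decay A B \<theta> T p N \<omega>
    by unfold_locales (fact T_pos theta_mono p_pos theta_per A1_comm N_pos omega_pos U_bound)+
  obtain \<epsilon> \<Delta> where eps: "\<epsilon> > 0" and Delta: "\<Delta> > 0"
    and sens: "\<And>\<delta> x. \<delta> > 0 \<Longrightarrow> x \<in> bdd_sols1 F \<Longrightarrow> \<exists>xb\<in>bdd_sols1 F. \<exists>t\<^sub>0 J.
      J \<subseteq> {t\<^sub>0..} \<and> interval_len_ge J \<Delta> \<and> norm (x t\<^sub>0 - xb t\<^sub>0) < \<delta> \<and>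
      (\<forall>t\<in>J. norm (x t - xb t) > \<epsilon>)"
    using sens1 by metis
  obtain M where M: "M > 0" "\<And>t x. x \<in> \<Lambda> \<Longrightarrow> norm (F t x) \<le> M"
    using periodic_bounded_on_compact[OF T_pos F_cont F_per Lambda_compact] by blast
  have "compact (g ` \<Lambda>)"
    by (intro compact_continuous_image continuous_on_subset[OF g_cont] Lambda_compact) simp
  then obtain Mg where Mg: "Mg > 0" "\<And>x. x \<in> \<Lambda> \<Longrightarrow> norm (g x) \<le> Mg"
    using compact_imp_bounded bounded_pos by (metis imageI)
  obtain Mf where Mf: "Mf > 0" "\<And>t y. norm (f t y) \<le> Mf" using A3_f by blast
  obtain Mw where Mw: "Mw > 0" "\<And>y. norm (W y) \<le> Mw" using A3_W by blast
  \<comment> \<open>Twice the a priori bound of \<open>bounded_sol_bound\<close>, so that H bounds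
    the difference of any two \<phi> x.\<close>
  define H where "H = 2 * (N * ((Mf + Mg) / \<omega> + real p * Mw / (1 - exp (- \<omega> * T))))"
  have phi_lin: "linear_imp_sol A B \<theta> (\<lambda>t. f t (\<phi> x t) + g (x t)) (\<lambda>k. W (\<phi> x (\<theta> k))) (\<phi> x)"
    if "x \<in> bdd_sols1 F" for x
    using phi_sol[OF that] is_sol2_imp_linear by blast
  have phi_bound: "norm (\<phi> x t) \<le> H / 2" if "x \<in> bdd_sols1 F" for x t
  proof -
    have "norm (f t (\<phi> x t) + g (x t)) \<le> Mf + Mg" for t
      using Mf(2)[of t "\<phi> x t"] Mg(2)[OF Lambda_traj[OF that, of t]]
        norm_triangle_ineq[of "f t (\<phi> x t)" "g (x t)"] by linarith
    then show ?thesis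
      using bounded_sol_bound[OF phi_lin[OF that] _ _ Mw(2)] phi_sol[OF that] by (simp add: H_def)
  qed
  define y where "y x xb t = \<phi> x t - \<phi> xb t" for x xb t
  have y_bound: "norm (y x xb t) \<le> H" if "x \<in> bdd_sols1 F" "xb \<in> bdd_sols1 F" for x xb t
    using phi_bound[OF that(1), of t] phi_bound[OF that(2), of t]
      norm_triangle_ineq4[of "\<phi> x t" "\<phi> xb t"] by (simp add: y_def)
  have H_nonneg: "H \<ge> 0"
    using A_ne y_bound norm_ge_zero by (metis all_not_in_conv order_trans)
  have x_der: "(x has_vector_derivative F t (x t)) (at t)" if "x \<in> bdd_sols1 F" for x t
    using that by (simp add: bdd_sols1_def is_sol1_def)
  \<comment> \<open>The forcing of the difference splits into r, controlled by the difference
    itself, and G, which depends only on the driving solutions.\<close>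
  define r where "r x xb t = f t (\<phi> x t) - f t (\<phi> xb t)" for x xb t
  define G where "G x xb t = g (x t) - g (xb t)" for x xb :: "real \<Rightarrow> real^'m" and t
  have r_le: "norm (r x xb t) \<le> L\<^sub>f * norm (y x xb t)" for x xb t
    unfolding r_def y_def by (rule A4_f)
  have G_le: "L\<^sub>1 * norm (x t - xb t) \<le> norm (G x xb t)" "norm (G x xb t) \<le> L\<^sub>2 * norm (x t - xb t)"
    if "x \<in> bdd_sols1 F" "xb \<in> bdd_sols1 F" for x xb t
    using A4_g Lambda_traj that by (auto simp: G_def)
  have y_lin: "linear_imp_sol A B \<theta> (\<lambda>t. r x xb t + G x xb t)
      (\<lambda>k. W (\<phi> x (\<theta> k)) - W (\<phi> xb (\<theta> k))) (y x xb)"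
    if "x \<in> bdd_sols1 F" "xb \<in> bdd_sols1 F" for x xb
  proof -
    have "(\<lambda>t. r x xb t + G x xb t)
        = (\<lambda>t. f t (\<phi> x t) + g (x t) - (f t (\<phi> xb t) + g (xb t)))"
      by (simp add: r_def G_def fun_eq_iff)
    then show ?thesis
      using linear_imp_sol_diff[OF phi_lin[OF that(1)] phi_lin[OF that(2)]]
      by (simp add: y_def[abs_def])
  qed
  obtain \<mu> where mu: "\<mu> > 0" "\<And>k. \<theta> k + \<mu> \<le> \<theta> (k + 1)" using theta_gap by blast
  define \<kappa> where "\<kappa> = L\<^sub>1 * \<epsilon>"
  have kappa: "\<kappa> > 0" using eps L_pos by (simp add: \<kappa>_def)
  \<comment> \<open>Bounded solutions of the first system are M-Lipschitz, so each of the two terms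
    of G is Lipschitz with constant L2 M.\<close>
  define \<Gamma> where "\<Gamma> = 2 * L\<^sub>2 * M"
  have Gamma: "\<Gamma> > 0" using L_pos M by (simp add: \<Gamma>_def)
  have G_lip: "norm (G x xb t - G x xb s) \<le> \<Gamma> * (t - s)"
    if mem: "x \<in> bdd_sols1 F" "xb \<in> bdd_sols1 F" and "s \<le> t" for x xb s t
  proof -
    have "norm (g (z t) - g (z s)) \<le> L\<^sub>2 * (M * (t - s))" if z: "z \<in> bdd_sols1 F" for z
    proof -
      have "norm (g (z t) - g (z s)) \<le> L\<^sub>2 * norm (z t - z s)"
        using A4_g Lambda_traj z by blast
      also have "norm (z t - z s) \<le> M * (t - s)"
        by (rule norm_diff_le_of_vector_derivative[OF \<open>s \<le> t\<close> x_der[OF z]])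
          (use M(2) Lambda_traj[OF z] in auto)
      finally show ?thesis using L_pos by (simp add: mult_left_mono)
    qed
    from this[OF mem(1)] this[OF mem(2)] show ?thesis
      using norm_triangle_ineq4[of "g (x t) - g (x s)" "g (xb t) - g (xb s)"]
      by (simp add: G_def \<Gamma>_def algebra_simps)
  qed
  \<comment> \<open>The three bounds let an interval of length 2d fit into J, make one of its halves
    jump-free, and keep the variation of G over time d below \<kappa>/2.\<close>
  define d where "d = min (min (\<Delta> / 2) (\<mu> / 2)) (\<kappa> / (2 * \<Gamma>))"
  have d: "d > 0" "2 * d \<le> \<Delta>" "2 * d \<le> \<mu>" "d \<le> \<kappa> / (2 * \<Gamma>)"
    using Delta mu(1) kappa Gamma by (auto simp: d_def)
  have Gamma_d: "\<Gamma> * d \<le> \<kappa> / 2"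
    using d(4) Gamma by (simp add: field_simps)
  define c where "c = opnorm A + L\<^sub>f"
  have c: "c \<ge> 0" using opnorm_nonneg[of A] L_pos by (simp add: c_def)
  \<comment> \<open>Solves the condition of \<open>forced_excursion\<close> on an interval of length
    d/4, with \<kappa>/4 in place of \<kappa>/2 to make it strict.\<close>
  define \<eta> where "\<eta> = \<kappa> / 4 * (d / 4) / (2 + c * (d / 4))"
  have den: "2 + c * (d / 4) > 0" using c d(1) by (simp add: add_pos_nonneg)
  have eta: "\<eta> > 0" "\<eta> * (2 + c * (d / 4)) < \<kappa> / 2 * (d / 4)"
  proof -
    show "\<eta> > 0"
      unfolding \<eta>_def using kappa d(1) den by (intro divide_pos_pos mult_pos_pos) auto
    have "\<eta> * (2 + c * (d / 4)) = \<kappa> / 4 * (d / 4)"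
      unfolding \<eta>_def using den by (simp only: nonzero_eq_divide_eq[symmetric] less_irrefl)
    also have "\<dots> < \<kappa> / 2 * (d / 4)" using kappa d(1) by simp
    finally show "\<eta> * (2 + c * (d / 4)) < \<kappa> / 2 * (d / 4)" .
  qed
  define K where "K = c * H + 2 * Mg"
  have K: "K > 0" using c H_nonneg Mg by (simp add: K_def add_nonneg_pos)
  \<comment> \<open>K bounds the speed of the difference off the jumps, so within time \<rho> its
    norm drops by at most \<eta>/2 and stays above \<eta>/4.\<close>
  define \<rho> where "\<rho> = min (d / 4) (\<eta> / (2 * K))"
  have rho: "\<rho> > 0" "\<rho> \<le> d / 4" "K * \<rho> \<le> \<eta> / 2"
  proof -
    show "\<rho> > 0" "\<rho> \<le> d / 4" using d(1) eta(1) K by (simp_all add: \<rho>_def)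
    have "\<rho> \<le> \<eta> / (2 * K)" by (simp add: \<rho>_def)
    then show "K * \<rho> \<le> \<eta> / 2" using K by (simp add: field_simps)
  qed
  have close: "\<exists>\<delta>\<^sub>0>0. \<forall>x\<in>bdd_sols1 F. \<forall>xb\<in>bdd_sols1 F. \<forall>t\<^sub>0.
      norm (x t\<^sub>0 - xb t\<^sub>0) < \<delta>\<^sub>0 \<longrightarrow> norm (y x xb t\<^sub>0) < \<delta>" if delta: "\<delta> > 0" for \<delta>
  proof -
    have nonneg: "0 \<le> L\<^sub>f" "0 \<le> L\<^sub>W" using L_pos by simp_all
    obtain \<sigma> \<gamma> where sg: "\<sigma> \<ge> 0" "\<gamma> > 0"
      and small: "\<And>h w z t0. linear_imp_sol A B \<theta> h w z \<Longrightarrow> (\<forall>t. norm (z t) \<le> H) \<Longrightarrow>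
        (\<forall>t. t0 - \<sigma> \<le> t \<longrightarrow> t \<le> t0 \<longrightarrow> norm (h t) \<le> L\<^sub>f * norm (z t) + \<gamma>) \<Longrightarrow>
        (\<forall>k. norm (w k) \<le> L\<^sub>W * norm (z (\<theta> k))) \<Longrightarrow> norm (z t0) < \<delta>"
      using small_after_long_time[OF nonneg A5 delta H_nonneg] by blast
    \<comment> \<open>The distance at \<open>t\<^sub>0\<close> grows backwards by at most
      exp(\<open>L\<^sub>F\<close> \<sigma>) over the window, and g multiplies it by at most
      \<open>L\<^sub>2\<close>; this choice makes the product equal to \<gamma>.\<close>
    define \<delta>\<^sub>0 where "\<delta>\<^sub>0 = \<gamma> / (L\<^sub>2 * exp (L\<^sub>F * \<sigma>))"
    have "norm (y x xb t\<^sub>0) < \<delta>"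
      if mem: "x \<in> bdd_sols1 F" "xb \<in> bdd_sols1 F" and near: "norm (x t\<^sub>0 - xb t\<^sub>0) < \<delta>\<^sub>0" for x xb t\<^sub>0
    proof (rule small[OF y_lin[OF mem]], safe)
      show "norm (y x xb t) \<le> H" for t using y_bound[OF mem] .
      show "norm (W (\<phi> x (\<theta> k)) - W (\<phi> xb (\<theta> k))) \<le> L\<^sub>W * norm (y x xb (\<theta> k))" for k
        unfolding y_def by (rule A4_W)
      fix t assume t: "t\<^sub>0 - \<sigma> \<le> t" "t \<le> t\<^sub>0"
      have "norm (x t - xb t) \<le> exp (L\<^sub>F * (t\<^sub>0 - t)) * norm (x t\<^sub>0 - xb t\<^sub>0)"
        by (rule backward_gronwall[OF t(2) x_der[OF mem(1)] x_der[OF mem(2)]])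
          (use A4_F Lambda_traj mem in blast)
      also have "\<dots> \<le> exp (L\<^sub>F * \<sigma>) * \<delta>\<^sub>0"
        using t near L_pos by (intro mult_mono) auto
      finally have "L\<^sub>2 * norm (x t - xb t) \<le> L\<^sub>2 * (exp (L\<^sub>F * \<sigma>) * \<delta>\<^sub>0)"
        using L_pos by (intro mult_left_mono) auto
      also have "\<dots> = \<gamma>" using L_pos by (simp add: \<delta>\<^sub>0_def)
      finally have "norm (G x xb t) \<le> \<gamma>" using G_le(2)[OF mem, of t] by linarith
      then show "norm (r x xb t + G x xb t) \<le> L\<^sub>f * norm (y x xb t) + \<gamma>"
        using r_le[of x xb t] norm_triangle_ineq[of "r x xb t" "G x xb t"] by linarith
    qed
    moreover have "\<delta>\<^sub>0 > 0" using sg L_pos by (simp add: \<delta>\<^sub>0_def)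
    ultimately show ?thesis by blast
  qed
  \<comment> \<open>The interval found contains no jump moment at all, which gives the required at
    most one.\<close>
  have far: "\<exists>J1\<subseteq>J. interval_len_ge J1 \<rho> \<and> range \<theta> \<inter> J1 = {} \<and> (\<forall>t\<in>J1. norm (y x xb t) > \<eta> / 4)"
    if mem: "x \<in> bdd_sols1 F" "xb \<in> bdd_sols1 F" and J: "interval_len_ge J \<Delta>"
      and sep: "\<And>t. t \<in> J \<Longrightarrow> norm (x t - xb t) > \<epsilon>" for x xb J
  proof -
    obtain a b where ab: "\<Delta> \<le> b - a" "{a<..<b} \<subseteq> J"
      using J unfolding interval_len_ge_def by blast
    obtain \<alpha> where alpha: "a \<le> \<alpha>" "\<alpha> + d \<le> a + 2 * d" "range \<theta> \<inter> {\<alpha><..<\<alpha> + d} = {}"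
      using jump_free_subinterval[OF mu(2) d(1) d(3)] by blast
    have sub: "{\<alpha><..<\<alpha> + d} \<subseteq> J"
      using ab alpha d(2) by (intro order_trans[OF _ ab(2)]) auto
    define r' where "r' t = A *v y x xb t + r x xb t" for t
    have der: "(y x xb has_vector_derivative (r' t + G x xb t)) (at t)"
      if "\<alpha> < t" "t < \<alpha> + d" for t
    proof -
      have "t \<notin> range \<theta>" using alpha(3) that by auto
      then show ?thesis
        using y_lin[OF mem] by (simp add: linear_imp_sol_def r'_def add.assoc)
    qed
    have r': "norm (r' t) \<le> c * norm (y x xb t)" for t
      using norm_triangle_ineq[of "A *v y x xb t" "r x xb t"] r_le[of x xb t]
        norm_matrix_vector_le[of A "y x xb t"] by (simp add: r'_def c_def distrib_right)
    \<comment> \<open>The excursion is sought in the second quarter of the jump-free interval. As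
      \<rho> \<le> d/4, the interval started there ends within the third quarter, so all times used
      are interior and y has a two-sided derivative.\<close>
    define l where "l = \<alpha> + d / 4"
    have "\<exists>\<xi>\<in>{l..l + d / 4}. norm (y x xb \<xi>) \<ge> \<eta>"
    proof (rule forced_excursion[where r = r' and G = "G x xb" and c = c and \<kappa> = \<kappa>])
      fix t assume t: "l \<le> t" "t \<le> l + d / 4"
      show "(y x xb has_vector_derivative (r' t + G x xb t)) (at t)"
        using t d(1) by (intro der) (simp_all add: l_def)
      have "norm (G x xb t - G x xb l) \<le> \<Gamma> * (t - l)"
        by (rule G_lip[OF mem t(1)])
      also have "\<dots> \<le> \<Gamma> * d"
        using t d(1) Gamma by (intro mult_left_mono) auto
      finally show "norm (G x xb t - G x xb l) \<le> \<kappa> / 2" using Gamma_d by linarith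
    next
      have "l \<in> J" using sub d(1) by (auto simp: l_def)
      then have "\<kappa> \<le> L\<^sub>1 * norm (x l - xb l)"
        using sep[of l] L_pos by (simp add: \<kappa>_def)
      then show "\<kappa> \<le> norm (G x xb l)" using G_le(1)[OF mem, of l] by linarith
    qed (use d(1) c r' eta(2) in auto)
    then obtain \<xi> where xi: "l \<le> \<xi>" "\<xi> \<le> l + d / 4" "norm (y x xb \<xi>) \<ge> \<eta>" by auto
    have inside: "{\<xi>..\<xi> + \<rho>} \<subseteq> {\<alpha><..<\<alpha> + d}"
      using xi rho(2) d(1) by (auto simp: l_def)
    have "norm (y x xb t) > \<eta> / 4" if t: "t \<in> {\<xi>..\<xi> + \<rho>}" for t
    proof -
      have "norm (y x xb t - y x xb \<xi>) \<le> K * (t - \<xi>)"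
      proof (rule norm_diff_le_of_vector_derivative)
        fix s assume s: "\<xi> \<le> s" "s \<le> t"
        then have "s \<in> {\<xi>..\<xi> + \<rho>}" using t by simp
        then have "s \<in> {\<alpha><..<\<alpha> + d}" using inside by blast
        then show "(y x xb has_vector_derivative (r' s + G x xb s)) (at s)"
          by (intro der) auto
        have "norm (r' s) \<le> c * H"
          using r'[of s] mult_left_mono[OF y_bound[OF mem] c, of s] by linarith
        moreover have "norm (G x xb s) \<le> 2 * Mg"
          using norm_triangle_ineq4[of "g (x s)" "g (xb s)"]
            Mg(2)[OF Lambda_traj[OF mem(1), of s]] Mg(2)[OF Lambda_traj[OF mem(2), of s]]
          by (simp add: G_def)
        ultimately show "norm (r' s + G x xb s) \<le> K"
          using norm_triangle_ineq[of "r' s" "G x xb s"] by (simp add: K_def)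
      qed (use t in simp)
      also have "\<dots> \<le> K * \<rho>" using t K by (intro mult_left_mono) auto
      finally show ?thesis
        using rho(3) eta(1) xi(3) norm_triangle_ineq2[of "y x xb \<xi>" "y x xb t"]
        by (simp add: norm_minus_commute)
    qed
    moreover have "interval_len_ge {\<xi>..\<xi> + \<rho>} \<rho>"
      unfolding interval_len_ge_def using rho(1) by (intro exI[of _ \<xi>] exI[of _ "\<xi> + \<rho>"]) auto
    moreover have "range \<theta> \<inter> {\<xi>..\<xi> + \<rho>} = {}" using inside alpha(3) by blast
    ultimately show ?thesis using inside sub by (intro exI[of _ "{\<xi>..\<xi> + \<rho>}"]) auto
  qed
  show ?thesis
  proof (rule exI[of _ "\<eta> / 4"], intro conjI, use eta(1) in simp, rule exI[of _ \<rho>], intro conjI,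
      fact rho(1), intro allI impI ballI)
    fix \<delta>\<^sub>1 :: real and x assume "\<delta>\<^sub>1 > 0" and x: "x \<in> bdd_sols1 F"
    obtain \<delta>\<^sub>0 where "\<delta>\<^sub>0 > 0" and near: "\<And>xb t\<^sub>0. xb \<in> bdd_sols1 F \<Longrightarrow>
        norm (x t\<^sub>0 - xb t\<^sub>0) < \<delta>\<^sub>0 \<Longrightarrow> norm (y x xb t\<^sub>0) < \<delta>\<^sub>1"
      using close[OF \<open>\<delta>\<^sub>1 > 0\<close>] x by blast
    obtain xb t\<^sub>0 J where xb: "xb \<in> bdd_sols1 F" and J: "J \<subseteq> {t\<^sub>0..}" "interval_len_ge J \<Delta>"
      and x0: "norm (x t\<^sub>0 - xb t\<^sub>0) < \<delta>\<^sub>0" and sep: "\<And>t. t \<in> J \<Longrightarrow> norm (x t - xb t) > \<epsilon>"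
      using sens[OF \<open>\<delta>\<^sub>0 > 0\<close> x] by blast
    obtain J1 where J1: "J1 \<subseteq> J" "interval_len_ge J1 \<rho>" "range \<theta> \<inter> J1 = {}"
      "\<forall>t\<in>J1. norm (y x xb t) > \<eta> / 4"
      using far[OF x xb J(2) sep] by blast
    show "\<exists>xb\<in>bdd_sols1 F. \<exists>t\<^sub>0 J1. J1 \<subseteq> {t\<^sub>0..} \<and> interval_len_ge J1 \<rho> \<and>
        (\<forall>k l. \<theta> k \<in> J1 \<longrightarrow> \<theta> l \<in> J1 \<longrightarrow> k = l) \<and>
        norm (\<phi> x t\<^sub>0 - \<phi> xb t\<^sub>0) < \<delta>\<^sub>1 \<and> (\<forall>t\<in>J1. norm (\<phi> x t - \<phi> xb t) > \<eta> / 4)"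
    proof (intro bexI[OF _ xb] exI conjI)
      show "J1 \<subseteq> {t\<^sub>0..}" using J1(1) J(1) by blast
      show "\<forall>k l. \<theta> k \<in> J1 \<longrightarrow> \<theta> l \<in> J1 \<longrightarrow> k = l" using J1(3) by blast
      show "norm (\<phi> x t\<^sub>0 - \<phi> xb t\<^sub>0) < \<delta>\<^sub>1" using near[OF xb x0] by (simp add: y_def)
      show "\<forall>t\<in>J1. norm (\<phi> x t - \<phi> xb t) > \<eta> / 4" using J1(4) by (simp add: y_def)
    qed (fact J1(2))
  qed
qed

end
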